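(* Let $E\subset\mathbb{T}$ be a closed set, let $\rho>0$ and $K>0$, and let $\phi(x)=\exp\{-x^{-\rho}\}$ for $x>0$, $\phi(0)=0$. Let $B$ be a Blaschke product whose zero set satisfies $Z(B)\subset\mathcal{S}_\phi(E,K)$, and let $\{z_n'\}=Z(B')$ be the zeros of $B'$ in $\mathbb{D}$. Then $$\sum_{n=1}^\infty (1-|z_n'|)\,d^{(\rho-\beta(E)+\varepsilon)_+}(z_n',E)<\infty\qquad\text{for all }\varepsilon>0,$$ where $\beta(E)$ is the type of $E$ and $(a)_+=\max(a,0)$.
   Context: $\mathbb{D}$ is the open unit disk in $\mathbb{C}$, $\mathbb{T}$ the unit circle, $d(z,E)=\mathrm{dist}(z,E)$ is the Euclidean distance from $z$ to $E$, and $d^{a}(z,E)=(d(z,E))^a$. Blaschke product: for a sequence $\{z_n\}_{n\ge1}\subset\mathbb{D}$ (repetitions allowed) with $\sum_{n=1}^\infty(1-|z_n|)<\infty$, $$B(z)=\prod_{n=1}^\infty b_n(z),\qquad b_n(z)=\frac{\overline{z_n}}{|z_n|}\,\frac{z_n-z}{1-\overline{z_n}z},$$ and $Z(B)=\{z_n\}$ is its zero set. Standing assumption: $B(0)\neq0$, i.e. all $z_n\ne0$. Zeros of $B'$ are listed with multiplicity; the sum is over all of them (there may be finitely many). Stolz region associated with $\phi$ and a closed set $E\subset\mathbb{T}$: for $K>0$, $\mathcal{S}_\phi(E,K)=\{\lambda\in\mathbb{D}:\ \phi(d(\lambda,E))\le K(1-|\lambda|)\}$. Type of a closed set $E\subset\mathbb{T}$: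 for $x>0$ let $E_x=\{t\in\mathbb{T}:\ d(t,E)<x\}$ and let $|E_x|$ be its normalized Lebesgue measure on $\mathbb{T}$; then $\beta(E)=\sup\{\beta\in\mathbb{R}:\ |E_x|=O(x^\beta),\ x\to0\}$. *)

theory Defs
  imports "HOL-Complex_Analysis.Complex_Analysis" "HOL-Library.Landau_Symbols"
begin

definition blaschke_factor :: "complex \<Rightarrow> complex \<Rightarrow> complex" where
  "blaschke_factor a w =
     cnj a / of_real (norm a) * ((a - w) / (1 - cnj a * w))"

(* Zeros are repeated according to multiplicity. The value is only meaningful for w in the
   open unit disk, where the product converges; finitely many factors may vanish there. *)
definition blaschke_product :: "(nat \<Rightarrow> complex) \<Rightarrow> complex \<Rightarrow> complex" where
  "blaschke_product z w = (\<Prod>n. blaschke_factor (z n) w)"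

definition blaschke_sequence :: "(nat \<Rightarrow> complex) \<Rightarrow> bool" where
  "blaschke_sequence z \<longleftrightarrow>
     (\<forall>n. z n \<in> ball 0 1) \<and> summable (\<lambda>n. 1 - norm (z n))"

definition stolz_region :: "(real \<Rightarrow> real) \<Rightarrow> complex set \<Rightarrow> real \<Rightarrow> complex set" where
  "stolz_region \<phi> E K =
     {w \<in> ball 0 1. \<phi> (infdist w E) \<le> K * (1 - norm w)}"

(* The value at 0 is set explicitly: since 0 powr a = 0, the formula alone would give 1. *)
definition exp_profile :: "real \<Rightarrow> real \<Rightarrow> real" where
  "exp_profile \<rho> x = (if x > 0 then exp (- (x powr (- \<rho>))) else 0)"

text \<open>Normalized Lebesgue measure on the unit circle.\<close>

definition circle_measure :: "complex set \<Rightarrow> real" where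
  "circle_measure A = measure lborel {\<theta> \<in> {0..<2 * pi}. cis \<theta> \<in> A} / (2 * pi)"

definition circle_nbhd :: "complex set \<Rightarrow> real \<Rightarrow> complex set" where
  "circle_nbhd E x = {t \<in> sphere 0 1. infdist t E < x}"

(* The set of admissible exponents contains 0, and for nonempty E it is bounded above by 1
   (an x-neighbourhood of a point has measure of order x), so the real supremum is proper. *)
definition set_type :: "complex set \<Rightarrow> real" where
  "set_type E =
     Sup {\<beta>::real. (\<lambda>x. circle_measure (circle_nbhd E x)) \<in> O[at_right 0](\<lambda>x. x powr \<beta>)}"

end

theory Submission
  imports Defs "HOL-Real_Asymp.Real_Asymp"
begin

text \<open>
  Write \<open>d\<close> for the distance to \<open>E\<close>. The proof has two independent halves.

  The derivative of the Blaschke product does not grow too fast: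
  \<open>\<bar>B'(w)\<bar> \<le> \<Sum>n. (1 - \<bar>z n\<bar>\<^sup>2) / \<bar>1 - cnj (z n) * w\<bar>\<^sup>2\<close>, and a zero \<open>z n\<close> can be close to \<open>w\<close> only if it is
  about as far from \<open>E\<close> as \<open>w\<close> is, in which case the Stolz condition keeps it away from the circle by
  \<open>exp (- d powr (- \<rho>))\<close>, up to constants. Hence \<open>ln \<bar>B'\<bar> \<le> A (1 + d powr (- \<rho>))\<close>
  (\<open>deriv_blaschke_product_growth\<close>).

  The zeros of every function \<open>f \<noteq> 0\<close> with such a bound satisfy the weighted Blaschke condition
  (\<open>weighted_zeros_summable\<close>). For fixed \<open>\<delta>\<close> consider the region \<open>d > \<delta>\<close>. Jensen's inequality there says
  that the Blaschke sum over the zeros with \<open>d \<ge> L \<delta>\<close>, \<open>L\<close> a large constant, is bounded, up to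
  constants that depend on a base point, by the value at this point of a harmonic function that
  majorizes \<open>ln \<bar>f\<bar>\<close> in the region (\<open>zeros_counted_by_majorant\<close>). A suitable majorant is, up to constants, the Poisson integral of
  \<open>max d \<delta> powr (- \<rho>)\<close>, whose value at the base point is comparable to the mean of this function over
  the circle. If \<open>E\<close> has neighbourhoods of measure \<open>O(x powr \<beta>)\<close>, this mean is \<open>O(\<delta> powr (- q))\<close> for
  every \<open>q \<ge> 0\<close> with \<open>q > \<rho> - \<beta>\<close> (\<open>profile_mass_growth\<close>). Adding up these estimates over dyadic \<open>\<delta>\<close> with the
  weights \<open>\<delta> powr a\<close> gives a convergent series if \<open>a > q\<close>; and if \<open>q = 0\<close> is possible, the unweighted sum
  is already bounded.

  Neither Green functions of the region nor Poisson integrals have to be constructed. The comparison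
  is an application of the maximum modulus principle to \<open>f\<close> divided by a finite Blaschke product and
  by the exponential of a holomorphic function whose real part is the majorant, and these holomorphic
  functions are finite sums of Herglotz kernels with poles outside the closed disk.
\<close>

section \<open>Herglotz kernels and Blaschke factors\<close>

text \<open>For a pole \<open>p\<close> outside the closed disk this is holomorphic with positive real part on the disk; the
real part is the Poisson kernel of the disk of radius \<open>norm p\<close>. Sums of such real parts are all the
harmonic majorants that occur below: a pole at distance \<open>s\<close> from the circle replaces a unit of mass
spread over an arc of length \<open>s\<close>, and carrying the holomorphic function along lets a majorant be
divided out by an exponential, so that the maximum modulus principle applies.\<close>

definition herglotz_kernel :: "complex \<Rightarrow> complex \<Rightarrow> complex" where
  "herglotz_kernel p z = (p + z) / (p - z)"

lemma holomorphic_herglotz_kernel: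
  assumes "norm p > 1"
  shows "herglotz_kernel p holomorphic_on ball 0 1"
  unfolding herglotz_kernel_def using assms by (intro holomorphic_intros) auto

lemma Re_herglotz_kernel:
  "Re (herglotz_kernel p z) = ((norm p)\<^sup>2 - (norm z)\<^sup>2) / (norm (p - z))\<^sup>2"
  unfolding herglotz_kernel_def Re_divide cmod_power2
  by (simp add: power2_eq_square algebra_simps)

lemma herglotz_kernel_lower:
  assumes "norm z < 1" "s > 0" "norm p = 1 + s"
  shows "Re (herglotz_kernel p z) \<ge> 2 * s / (norm (p - z))\<^sup>2"
proof -
  have "(norm z)\<^sup>2 \<le> 1" using assms by (simp add: power_le_one)
  moreover have "(norm p)\<^sup>2 = 1 + 2 * s + s\<^sup>2"
    using assms by (simp add: power2_sum)
  ultimately have "2 * s \<le> (norm p)\<^sup>2 - (norm z)\<^sup>2"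
    using zero_le_power2[of s] by linarith
  then show ?thesis unfolding Re_herglotz_kernel by (intro divide_right_mono) auto
qed

text \<open>At a fixed base point a unit mass contributes a bounded amount, however close its pole is to the
circle.\<close>

lemma herglotz_kernel_upper:
  assumes "norm z < 1" "s > 0" "norm p = 1 + s"
  shows "Re (herglotz_kernel p z) \<le> 2 / (1 - norm z)"
proof -
  have pz: "norm (p - z) \<ge> 1 + s - norm z"
    using norm_triangle_ineq2[of p z] assms by simp
  have "Re (herglotz_kernel p z) \<le> norm (p + z) / norm (p - z)"
    using complex_Re_le_cmod[of "herglotz_kernel p z"] by (simp add: herglotz_kernel_def norm_divide)
  also have "\<dots> \<le> (2 + s) / (1 + s - norm z)"
    using pz assms norm_triangle_ineq[of p z] by (intro frac_le) auto
  also have "\<dots> \<le> 2 / (1 - norm z)"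
  proof -
    have "s * (1 - norm z) \<le> s * 2"
      using assms norm_ge_zero[of z] by (intro mult_left_mono) linarith+
    then show ?thesis using assms by (simp add: field_simps)
  qed
  finally show ?thesis .
qed

lemma norm_one_minus_cnj_mult_sq:
  "(norm (1 - cnj a * z))\<^sup>2 = (norm (z - a))\<^sup>2 + (1 - (norm a)\<^sup>2) * (1 - (norm z)\<^sup>2)"
  unfolding cmod_power2 by (simp add: power2_eq_square algebra_simps)

lemma one_minus_cnj_mult_nonzero:
  assumes "norm a < 1" "norm z < 1"
  shows "1 - cnj a * z \<noteq> 0"
proof
  assume "1 - cnj a * z = 0"
  then have "norm (cnj a * z) = 1" by simp
  then show False using assms mult_strict_mono'[of "norm a" 1 "norm z" 1] by (simp add: norm_mult)
qed

lemma norm_sq_less_one: "norm (z::complex) < 1 \<Longrightarrow> (norm z)\<^sup>2 < 1"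
  by (simp add: power_less_one_iff abs_square_less_1)

text \<open>\<open>- ln \<bar>b\<^sub>a(z)\<bar>\<close>, where \<open>b\<^sub>a(z) = (z - a) / (1 - cnj a * z)\<close>, is the Green function of the disk with
pole \<open>a\<close>, and the bound shows its linear decay at the circle in both arguments. With
\<open>p = (1 - \<bar>a\<bar>\<^sup>2) (1 - \<bar>z\<bar>\<^sup>2)\<close>
the formula for \<open>\<bar>1 - cnj a * z\<bar>\<^sup>2\<close> gives \<open>- 2 ln \<bar>b\<^sub>a(z)\<bar> = ln (1 + p / \<bar>z - a\<bar>\<^sup>2)\<close>.\<close>

lemma neg_ln_blaschke_upper:
  assumes a: "norm a < 1" and z: "norm z < 1" and ne: "z \<noteq> a"
  shows "- ln (norm ((z - a) / (1 - cnj a * z)))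
           \<le> (1 - (norm a)\<^sup>2) * (1 - (norm z)\<^sup>2) / (2 * (norm (z - a))\<^sup>2)"
proof -
  define p where "p = (1 - (norm a)\<^sup>2) * (1 - (norm z)\<^sup>2)"
  define q where "q = norm (z - a)"
  define r where "r = norm (1 - cnj a * z)"
  have p: "p > 0" unfolding p_def using norm_sq_less_one[OF a] norm_sq_less_one[OF z] by simp
  have q: "q > 0" using ne by (simp add: q_def)
  have r: "r > 0" using one_minus_cnj_mult_nonzero[OF a z] by (simp add: r_def)
  have rq: "r\<^sup>2 = q\<^sup>2 + p" unfolding r_def q_def p_def by (rule norm_one_minus_cnj_mult_sq)
  have "- 2 * ln (q / r) = ln ((r / q)\<^sup>2)"
    using q r by (simp add: ln_div ln_realpow)
  also have "(r / q)\<^sup>2 = 1 + p / q\<^sup>2"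
    using q by (simp add: power_divide rq field_simps)
  also have "ln (1 + p / q\<^sup>2) \<le> p / q\<^sup>2"
    using p q by (intro ln_add_one_self_le_self) auto
  finally have "- ln (q / r) \<le> p / (2 * q\<^sup>2)" by (simp add: field_simps)
  then show ?thesis unfolding p_def q_def r_def by (simp add: norm_divide)
qed

text \<open>Read at a fixed \<open>z\<close>: every zero \<open>a\<close> that is divided out of a function raises its logarithm at \<open>z\<close> by
at least a multiple of \<open>1 - \<bar>a\<bar>\<close>. This is what makes the Blaschke sum appear.\<close>

lemma neg_ln_blaschke_lower:
  assumes a: "norm a < 1" and z: "norm z < 1" and ne: "z \<noteq> a"
  shows "- ln (norm ((z - a) / (1 - cnj a * z))) \<ge> (1 - norm a) * (1 - norm z) / 8"
proof -
  define p where "p = (1 - (norm a)\<^sup>2) * (1 - (norm z)\<^sup>2)"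
  define q where "q = norm (z - a)"
  define r where "r = norm (1 - cnj a * z)"
  have p: "p > 0" unfolding p_def using norm_sq_less_one[OF a] norm_sq_less_one[OF z] by simp
  have q: "q > 0" using ne by (simp add: q_def)
  have r: "r > 0" using one_minus_cnj_mult_nonzero[OF a z] by (simp add: r_def)
  have rq: "r\<^sup>2 = q\<^sup>2 + p" unfolding r_def q_def p_def by (rule norm_one_minus_cnj_mult_sq)
  have le: "1 - norm a \<le> 1 - (norm a)\<^sup>2" "1 - norm z \<le> 1 - (norm z)\<^sup>2"
    using a z by (simp_all add: power2_eq_square mult_left_le_one_le)
  have "r \<le> 1 + norm a * norm z"
    unfolding r_def using norm_triangle_ineq4[of 1 "cnj a * z"] by (simp add: norm_mult)
  also have "norm a * norm z \<le> 1" using a z by (simp add: mult_le_one)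
  finally have "r \<le> 2" by simp
  then have r4: "r\<^sup>2 \<le> 4" using r power_mono[of r 2 2] by simp
  have pp: "(1 - norm a) * (1 - norm z) \<le> p"
    unfolding p_def using le a z by (intro mult_mono) auto
  have "2 * ln (q / r) = ln ((q / r)\<^sup>2)" using q r by (simp add: ln_realpow)
  also have "\<dots> \<le> (q / r)\<^sup>2 - 1" using q r by (intro ln_le_minus_one) auto
  also have "\<dots> = - (p / r\<^sup>2)"
  proof -
    have "p / r\<^sup>2 = (r\<^sup>2 - q\<^sup>2) / r\<^sup>2" by (simp add: rq)
    then show ?thesis using r by (simp add: power_divide diff_divide_distrib)
  qed
  also have "\<dots> \<le> - (p / 4)"
    using p r r4 by (intro le_imp_neg_le divide_left_mono) auto
  finally show ?thesis using pp unfolding q_def r_def by (simp add: norm_divide field_simps)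
qed

lemma radial_pole_exists:
  fixes a :: complex
  assumes "s > 0" "norm a < 1"
  obtains p where "norm p = 1 + s" "norm (p - a) = 1 + s - norm a"
proof -
  define u where "u = cis (Arg a)"
  have a: "a = of_real (norm a) * u"
    unfolding u_def by (metis rcis_cmod_Arg rcis_def)
  show thesis
  proof (rule that[of "of_real (1 + s) * u"])
    show "norm (of_real (1 + s) * u) = 1 + s"
      using assms by (simp add: norm_mult u_def del: of_real_add)
    have "of_real (1 + s) * u - a = of_real (1 + s - norm a) * u"
      by (subst a) (simp add: algebra_simps)
    then show "norm (of_real (1 + s) * u - a) = 1 + s - norm a"
      using assms by (simp add: norm_mult u_def del: of_real_add of_real_diff)
  qed
qed

text \<open>If \<open>z\<close> is within \<open>\<delta>\<close> of the circle and at distance at least \<open>s \<ge> \<delta>\<close> from \<open>a\<close>, then the Green function with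
pole \<open>a\<close> is at most of order \<open>\<delta> (1 - \<bar>a\<bar>) / \<bar>z - a\<bar>\<^sup>2\<close>. Pushing the pole radially to \<open>p\<close>, at distance
\<open>s\<close> outside the circle, keeps \<open>\<bar>p - z\<bar> \<le> 4 \<bar>z - a\<bar>\<close>, so the Herglotz kernel of \<open>p\<close>, of order at least
\<open>s / \<bar>p - z\<bar>\<^sup>2\<close>, dominates it. The gain is the factor \<open>\<delta> / s\<close>: for \<open>s\<close> a large multiple of \<open>\<delta>\<close> the
barrier is negligible at a fixed base point compared with \<open>1 - \<bar>a\<bar>\<close>.\<close>

lemma barrier_dominates:
  assumes a: "norm a < 1" and z: "norm z < 1" and \<delta>: "0 < \<delta>" "\<delta> \<le> s"
    and za: "s \<le> norm (z - a)" and zd: "1 - norm z \<le> \<delta>"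
    and np: "norm p = 1 + s" and pa: "norm (p - a) = 1 + s - norm a"
  shows "- ln (norm ((z - a) / (1 - cnj a * z)))
      \<le> 16 * \<delta> * (1 - norm a) / s * Re (herglotz_kernel p z)"
proof -
  have s: "s > 0" using \<delta> by simp
  have ne: "z \<noteq> a" using za s by auto
  have "norm z \<le> norm (z - a) + norm a" using norm_triangle_sub[of z a] by simp
  then have "norm (p - a) \<le> 3 * norm (z - a)" using pa za zd \<delta> by linarith
  then have pz: "norm (p - z) \<le> 4 * norm (z - a)"
    using norm_triangle_ineq4[of "p - a" "z - a"] by simp
  have pz0: "norm (p - z) > 0" using norm_triangle_ineq2[of p z] np z s by linarith
  have za0: "norm (z - a) > 0" using ne by simp
  have "2 * s / (16 * (norm (z - a))\<^sup>2) \<le> 2 * s / (norm (p - z))\<^sup>2"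
  proof (intro divide_left_mono)
    show "(norm (p - z))\<^sup>2 \<le> 16 * (norm (z - a))\<^sup>2"
      using power_mono[OF pz, of 2] by (simp add: power_mult_distrib)
  qed (use s pz0 za0 in auto)
  also have "\<dots> \<le> Re (herglotz_kernel p z)" by (rule herglotz_kernel_lower[OF z s np])
  finally have k: "1 / (norm (z - a))\<^sup>2 \<le> 8 / s * Re (herglotz_kernel p z)"
    using s by (simp add: field_simps)
  have a2: "1 - (norm a)\<^sup>2 \<le> 2 * (1 - norm a)" 
    using zero_le_power2[of "1 - norm a"] by (simp add: power2_eq_square algebra_simps)
  have z2: "1 - (norm z)\<^sup>2 \<le> 2 * \<delta>" 
    using zero_le_power2[of "1 - norm z"] zd by (simp add: power2_eq_square algebra_simps)
  have "- ln (norm ((z - a) / (1 - cnj a * z)))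
      \<le> (1 - (norm a)\<^sup>2) * (1 - (norm z)\<^sup>2) / (2 * (norm (z - a))\<^sup>2)"
    by (rule neg_ln_blaschke_upper[OF a z ne])
  also have "\<dots> \<le> (2 * (1 - norm a)) * (2 * \<delta>) / (2 * (norm (z - a))\<^sup>2)"
    using a2 z2 norm_sq_less_one[OF z] norm_sq_less_one[OF a] a
    by (intro divide_right_mono mult_mono) auto
  also have "\<dots> = 2 * \<delta> * (1 - norm a) * (1 / (norm (z - a))\<^sup>2)" by simp
  also have "\<dots> \<le> 2 * \<delta> * (1 - norm a) * (8 / s * Re (herglotz_kernel p z))"
    using a \<delta> by (intro mult_left_mono[OF k]) auto
  finally show ?thesis by simp
qed

section \<open>Zeros in the complement of a neighbourhood of E\<close>

text \<open>By induction on \<open>F\<close>. The orders of the zeros of the quotient need not be related to those of \<open>f\<close>: the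
product split off so far does not vanish at the new point \<open>w\<close>, so the local factorization of \<open>f\<close> at \<open>w\<close>
is one of the quotient as well.\<close>

lemma split_off_zeros:
  assumes "f holomorphic_on S" "open S" "connected S" "z0 \<in> S" "f z0 \<noteq> 0" "finite F" "F \<subseteq> S"
  shows "\<exists>g. g holomorphic_on S \<and> (\<forall>z\<in>S. f z = g z * (\<Prod>w\<in>F. (z - w) ^ nat (zorder f w)))"
  using assms(6,7)
proof (induction F rule: finite_induct)
  case empty
  then show ?case using assms(1) by auto
next
  case (insert w F)
  define n where "n = nat (zorder f w)"
  define P where "P z = (\<Prod>w\<in>F. (z - w) ^ nat (zorder f w))" for z :: complex
  define u where "u = zor_poly f w"
  obtain g where g: "g holomorphic_on S" and fg: "\<And>z. z \<in> S \<Longrightarrow> f z = g z * P z"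
    using insert unfolding P_def by auto
  have w: "w \<in> S" using insert by auto
  obtain r where r: "r > 0" "cball w r \<subseteq> S" "u holomorphic_on cball w r"
      "\<And>z. z \<in> cball w r \<Longrightarrow> f z = u z * (z - w) ^ n"
    using zorder_exist_zero[OF assms(1-3) w] assms(4,5) unfolding n_def u_def by blast
  have contP: "continuous (at w) P"
    unfolding P_def by (intro continuous_intros)
  have "P w \<noteq> 0" using insert unfolding P_def by auto
  then obtain e where e: "e > 0" "\<And>z. dist w z < e \<Longrightarrow> P z \<noteq> 0"
    using continuous_at_avoid[OF contP, of 0] by blast
  define d where "d = min e r"
  have d: "d > 0" using e r by (simp add: d_def)
  define h where "h z = (if z = w then u w / P w else g z / (z - w) ^ n)" for z
  have hball: "h z = u z / P z" if "z \<in> ball w d" for z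
  proof (cases "z = w")
    case False
    have "z \<in> cball w r" "P z \<noteq> 0" using that e by (auto simp: d_def)
    moreover have "z \<in> S" using calculation r by auto
    ultimately have "g z * P z = u z * (z - w) ^ n" using fg r(4) by metis
    with \<open>P z \<noteq> 0\<close> False show ?thesis by (simp add: h_def field_simps)
  qed (simp add: h_def)
  have "h holomorphic_on (S - {w}) \<union> ball w d"
  proof (rule holomorphic_on_Un)
    have "(\<lambda>z. g z / (z - w) ^ n) holomorphic_on S - {w}"
      by (intro holomorphic_intros holomorphic_on_subset[OF g]) auto
    then show "h holomorphic_on S - {w}"
      by (rule holomorphic_transform) (auto simp: h_def)
    have "(\<lambda>z. u z / P z) holomorphic_on ball w d"
      unfolding P_def
      by (intro holomorphic_intros holomorphic_on_subset[OF r(3)])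
         (use e in \<open>auto simp: d_def P_def\<close>)
    then show "h holomorphic_on ball w d"
      by (rule holomorphic_transform) (auto simp: hball)
  qed (use \<open>open S\<close> in auto)
  moreover have "ball w d \<subseteq> S" using r by (auto simp: d_def)
  ultimately have h: "h holomorphic_on S"
    using w d by (elim holomorphic_on_subset) auto
  have "f z = h z * (\<Prod>w\<in>insert w F. (z - w) ^ nat (zorder f w))" if "z \<in> S" for z
  proof (cases "z = w")
    case True
    have "f w = u w * 0 ^ n" using r(4)[of w] r(1) by simp
    then show ?thesis using True insert \<open>P w \<noteq> 0\<close>
      by (simp add: h_def n_def flip: P_def)
  next
    case False
    then show ?thesis using that insert fg[OF that] by (simp add: h_def n_def flip: P_def)
  qed
  with h show ?case by blast
qed

lemma one_minus_norm_le_infdist: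
  assumes "E \<subseteq> sphere 0 1" "E \<noteq> {}"
  shows "1 - norm z \<le> infdist z E"
proof -
  have "1 - norm z \<le> dist z e" if "e \<in> E" for e
    using assms that norm_triangle_sub[of e z] by (auto simp: dist_norm norm_minus_commute)
  then show ?thesis unfolding infdist_notempty[OF assms(2)] by (intro cINF_greatest assms)
qed

text \<open>A Jensen inequality for the region \<open>{z. \<delta> < infdist z E}\<close>. Divide out the zeros in \<open>F\<close>. On the circle
this leaves the modulus of \<open>f\<close> unchanged, but near \<open>E\<close>, on the inner boundary of the region, it
enlarges \<open>ln \<bar>f\<bar>\<close> by the Green potential of \<open>F\<close>. As the zeros keep a distance from the inner boundary
that is a large multiple of \<open>\<delta>\<close>, barriers absorb this potential at the cost of half of the gain at \<open>z0\<close>. The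
maximum modulus principle for the quotient times \<open>exp (- \<Psi>)\<close> then bounds the Blaschke sum by the
majorant at \<open>z0\<close>.\<close>

lemma zeros_counted_by_majorant:
  fixes f \<Phi> :: "complex \<Rightarrow> complex"
  assumes f: "f holomorphic_on ball 0 1" and z0: "norm z0 < 1" "f z0 \<noteq> 0"
    and E: "E \<subseteq> sphere 0 1" "E \<noteq> {}"
    and \<Phi>: "\<Phi> holomorphic_on ball 0 1"
    and bd: "\<And>z. norm z < 1 \<Longrightarrow> \<delta> \<le> infdist z E \<Longrightarrow> norm (f z) \<le> exp (Re (\<Phi> z))"
    and \<delta>: "0 < \<delta>" "\<delta> < 1 - norm z0"
    and F: "finite F" 
      "\<And>w. w \<in> F \<Longrightarrow> norm w < 1 \<and> f w = 0 \<and> (1 + 512 / (1 - norm z0)\<^sup>2) * \<delta> \<le> infdist w E"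
  shows "(\<Sum>w\<in>F. real (nat (zorder f w)) * (1 - norm w))
           \<le> 16 / (1 - norm z0) * (Re (\<Phi> z0) + 1 - ln (norm (f z0)))"
proof -
  define t where "t = 1 - norm z0"
  have t: "0 < t" "t \<le> 1" using z0 by (auto simp: t_def)
  define s where "s = 512 / t\<^sup>2 * \<delta>"
  define m where "m w = real (nat (zorder f w))" for w
  define b where "b w z = (z - w) / (1 - cnj w * z)" for w z
  define c where "c w = 16 * \<delta> * (1 - norm w) / s" for w :: complex
  have "t\<^sup>2 \<le> 1" using t by (simp add: power_le_one)
  then have "1 * \<delta> \<le> 512 / t\<^sup>2 * \<delta>"
    using t \<delta> by (intro mult_right_mono) (auto simp: field_simps)
  then have s: "\<delta> \<le> s" by (simp add: s_def)
  then have s0: "s > 0" using \<delta> by simp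
  have m0: "m w \<ge> 0" for w by (simp add: m_def)
  have Fs: "norm w < 1" "f w = 0" "\<delta> + s \<le> infdist w E" if "w \<in> F" for w
    using F(2)[OF that] by (auto simp: s_def t_def algebra_simps)
  have c0: "c w \<ge> 0" if "w \<in> F" for w
    using Fs[OF that] \<delta> s0 by (simp add: c_def)
  have "\<forall>w\<in>F. \<exists>p. norm p = 1 + s \<and> norm (p - w) = 1 + s - norm w"
    using radial_pole_exists[OF s0] Fs by metis
  then obtain p where p: "\<And>w. w \<in> F \<Longrightarrow> norm (p w) = 1 + s"
      "\<And>w. w \<in> F \<Longrightarrow> norm (p w - w) = 1 + s - norm w"
    by metis
  obtain g where g: "g holomorphic_on ball 0 1"
      "\<And>z. z \<in> ball 0 1 \<Longrightarrow> f z = g z * (\<Prod>w\<in>F. (z - w) ^ nat (zorder f w))"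
    using split_off_zeros[of f "ball 0 1" z0 F] f z0 F Fs by (auto simp: subset_iff)
  \<comment> \<open>\<open>g1\<close> is \<open>f\<close> divided by the finite Blaschke product of its zeros in \<open>F\<close>, and \<open>\<Psi>\<close> adds to \<open>\<Phi>\<close> one
      barrier for each of these zeros.\<close>
  define g1 where "g1 z = g z * (\<Prod>w\<in>F. (1 - cnj w * z) ^ nat (zorder f w))" for z
  define \<Psi> where "\<Psi> z = \<Phi> z + 1 + (\<Sum>w\<in>F. of_real (m w * c w) * herglotz_kernel (p w) z)" for z
  define G where "G z = g1 z * exp (- \<Psi> z)" for z
  have Re\<Psi>: "Re (\<Psi> z) = Re (\<Phi> z) + 1 + (\<Sum>w\<in>F. m w * (c w * Re (herglotz_kernel (p w) z)))" for z
    unfolding \<Psi>_def by (simp add: mult.assoc)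
  have holG: "G holomorphic_on ball 0 1"
    unfolding G_def \<Psi>_def g1_def
    by (intro holomorphic_intros g \<Phi> holomorphic_herglotz_kernel) (use p s0 in auto)
  have g1f: "norm (g1 z) = norm (f z) * exp (\<Sum>w\<in>F. m w * - ln (norm (b w z)))"
    if z: "norm z < 1" "z \<notin> F" for z
  proof -
    have "norm (1 - cnj w * z) ^ nat (zorder f w)
        = norm (z - w) ^ nat (zorder f w) * exp (m w * - ln (norm (b w z)))" if "w \<in> F" for w
    proof -
      have nz: "norm (1 - cnj w * z) > 0" "norm (z - w) > 0"
        using one_minus_cnj_mult_nonzero[of w z] Fs that z by auto
      have "exp (m w * - ln (norm (b w z))) = exp (- ln (norm (b w z))) ^ nat (zorder f w)"
        unfolding m_def by (rule exp_of_nat_mult)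
      also have "exp (- ln (norm (b w z))) = norm (1 - cnj w * z) / norm (z - w)"
        using nz by (simp add: b_def norm_divide exp_minus)
      finally show ?thesis using nz by (simp add: power_divide)
    qed
    then have "(\<Prod>w\<in>F. norm (1 - cnj w * z) ^ nat (zorder f w))
        = (\<Prod>w\<in>F. norm (z - w) ^ nat (zorder f w)) * exp (\<Sum>w\<in>F. m w * - ln (norm (b w z)))"
      by (simp add: exp_sum F prod.distrib)
    then show ?thesis using g(2)[of z] z
      by (simp add: g1_def norm_mult norm_power flip: prod_norm)
  qed
  have normG: "norm (G z) = norm (g1 z) / exp (Re (\<Psi> z))" for z
    by (simp add: G_def norm_mult exp_minus norm_inverse divide_inverse)
  have small: "norm (G z) \<le> 1" 
    if z: "norm z < 1" "z \<notin> F" "\<delta> \<le> infdist z E"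
      and le: "(\<Sum>w\<in>F. m w * - ln (norm (b w z)))
                 \<le> 1 + (\<Sum>w\<in>F. m w * (c w * Re (herglotz_kernel (p w) z)))" for z
  proof -
    have "norm (g1 z) \<le> exp (Re (\<Phi> z)) * exp (\<Sum>w\<in>F. m w * - ln (norm (b w z)))"
      unfolding g1f[OF z(1,2)] by (intro mult_right_mono bd z) auto
    also have "\<dots> \<le> exp (Re (\<Psi> z))"
      unfolding exp_add[symmetric] exp_le_cancel_iff Re\<Psi> using le by linarith
    finally show ?thesis by (simp add: normG)
  qed
  \<comment> \<open>For finitely many zeros the Green potential tends to 0 at the circle, so on a circle of radius
      \<open>R\<close> close to 1 it is at most 1: this is the summand 1 in \<open>\<Psi>\<close>.\<close>
  define D where "D R = (\<Sum>w\<in>F. m w * ((1 - (norm w)\<^sup>2) * (1 - R\<^sup>2) / (2 * (R - norm w)\<^sup>2)))" for R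
  have "(D \<longlongrightarrow> (\<Sum>w\<in>F. m w * ((1 - (norm w)\<^sup>2) * (1 - 1\<^sup>2) / (2 * (1 - norm w)\<^sup>2)))) (at_left 1)"
    unfolding D_def by (intro tendsto_intros) (use Fs in force)
  then have "\<forall>\<^sub>F R in at_left 1. D R < 1"
    by (rule order_tendstoD) simp
  moreover have "\<forall>\<^sub>F R in at_left 1. \<forall>w\<in>insert z0 F. norm w < R"
    using F z0 Fs by (intro eventually_ball_finite) (auto intro: eventually_at_left_real
        simp: eventually_at_left_field)
  moreover have "\<forall>\<^sub>F R in at_left (1::real). R < 1"
    by (simp add: eventually_at_filter)
  ultimately have "\<forall>\<^sub>F R in at_left 1. D R < 1 \<and> (\<forall>w\<in>insert z0 F. norm w < R) \<and> R < 1"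
    by eventually_elim auto
  then obtain R where R: "D R < 1" "\<And>w. w \<in> F \<Longrightarrow> norm w < R" "norm z0 < R" "R < 1"
    using eventually_happens'[of "at_left (1::real)"] by force
  define S where "S = ball 0 R \<inter> {z. \<delta> < infdist z E}"
  have openS: "open S" unfolding S_def
    by (intro open_Int open_Collect_less continuous_intros) auto
  have closS: "closure S \<subseteq> cball 0 R \<inter> {z. \<delta> \<le> infdist z E}"
    unfolding S_def
    by (intro closure_minimal closed_Int closed_Collect_le continuous_intros) auto
  have sub: "closure S \<subseteq> ball 0 1" using closS R by auto
  have kpos: "Re (herglotz_kernel (p w) z) \<ge> 0" if "w \<in> F" "norm z < 1" for w z
    by (rule order_trans[OF _ herglotz_kernel_lower[OF that(2) s0 p(1)[OF that(1)]]]) (use s0 in auto)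
  have "norm (G z0) \<le> 1"
  proof (rule maximum_modulus_frontier[of G S])
    show "G holomorphic_on interior S"
      using holG by (rule holomorphic_on_subset) (use sub interior_subset closure_subset in blast)
    show "continuous_on (closure S) G"
      using holomorphic_on_imp_continuous_on[OF holG] sub continuous_on_subset by blast
    show "bounded S" by (rule bounded_subset[of "ball 0 R"]) (auto simp: S_def)
    have "1 - norm z0 \<le> infdist z0 E" by (rule one_minus_norm_le_infdist[OF E])
    then show "z0 \<in> S" using R \<delta> by (auto simp: S_def)
  next
    fix z assume "z \<in> frontier S"
    then have zc: "norm z \<le> R" "\<delta> \<le> infdist z E" and zS: "z \<notin> S"
      using closS openS by (auto simp: frontier_def interior_open)
    then have z1: "norm z < 1" using R by simp
    \<comment> \<open>On the outer part of the boundary the potential is small by the choice of \<open>R\<close>; on the part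
      near \<open>E\<close> the barriers dominate it.\<close>
    consider "norm z = R" | "infdist z E = \<delta>" using zc zS by (force simp: S_def)
    then show "norm (G z) \<le> 1"
    proof cases
      case 1
      have "z \<notin> F" using R(2) 1 by auto
      have "(\<Sum>w\<in>F. m w * - ln (norm (b w z))) \<le> D R"
        unfolding D_def
      proof (intro sum_mono mult_left_mono m0)
        fix w assume w: "w \<in> F"
        have "- ln (norm (b w z)) \<le> (1 - (norm w)\<^sup>2) * (1 - (norm z)\<^sup>2) / (2 * (norm (z - w))\<^sup>2)"
          unfolding b_def by (rule neg_ln_blaschke_upper) (use Fs w z1 \<open>z \<notin> F\<close> in auto)
        also have "\<dots> \<le> (1 - (norm w)\<^sup>2) * (1 - R\<^sup>2) / (2 * (R - norm w)\<^sup>2)"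
          unfolding 1
        proof (intro divide_left_mono mult_left_mono power_mono mult_nonneg_nonneg)
          show "R - norm w \<le> norm (z - w)" using 1 norm_triangle_ineq2[of z w] by simp
          show "0 < 2 * (norm (z - w))\<^sup>2 * (2 * (R - norm w)\<^sup>2)"
          proof -
            have "0 < norm (z - w)" "0 < R - norm w" using R(2)[OF w] w \<open>z \<notin> F\<close> by auto
            then show ?thesis by simp
          qed
        qed (use R(2)[OF w] norm_sq_less_one[of w] norm_sq_less_one[OF z1] Fs[OF w] 1 in auto)
        finally show "- ln (norm (b w z)) \<le> (1 - (norm w)\<^sup>2) * (1 - R\<^sup>2) / (2 * (R - norm w)\<^sup>2)" .
      qed
      moreover have "0 \<le> (\<Sum>w\<in>F. m w * (c w * Re (herglotz_kernel (p w) z)))"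
        by (intro sum_nonneg mult_nonneg_nonneg m0 c0 kpos z1)
      ultimately show ?thesis
        using R(1) by (intro small z1 \<open>z \<notin> F\<close> zc) linarith
    next
      case 2
      have dist: "s \<le> norm (z - w)" if "w \<in> F" for w
        using Fs(3)[OF that] infdist_triangle[of w E z] 2 by (simp add: dist_norm norm_minus_commute)
      have "z \<notin> F" using dist[of z] s0 by auto
      have "1 - norm z \<le> \<delta>" using one_minus_norm_le_infdist[OF E, of z] 2 by simp
      then have "(\<Sum>w\<in>F. m w * - ln (norm (b w z)))
          \<le> (\<Sum>w\<in>F. m w * (c w * Re (herglotz_kernel (p w) z)))"
        unfolding b_def c_def
        by (intro sum_mono mult_left_mono m0 barrier_dominates Fs z1 \<delta> s dist p)
      then show ?thesis by (intro small z1 \<open>z \<notin> F\<close> zc) linarith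
    qed
  qed
  then have "norm (g1 z0) \<le> exp (Re (\<Psi> z0))"
    by (simp add: normG)
  have z0F: "z0 \<notin> F" using Fs(2) z0 by auto
  have "norm (f z0) * exp (\<Sum>w\<in>F. m w * - ln (norm (b w z0))) \<le> exp (Re (\<Psi> z0))"
    using \<open>norm (g1 z0) \<le> _\<close> g1f[OF z0(1) z0F] by simp
  then have "ln (norm (f z0) * exp (\<Sum>w\<in>F. m w * - ln (norm (b w z0)))) \<le> ln (exp (Re (\<Psi> z0)))"
    by (subst ln_le_cancel_iff) (use z0 in auto)
  then have main: "ln (norm (f z0)) + (\<Sum>w\<in>F. m w * - ln (norm (b w z0))) \<le> Re (\<Psi> z0)"
    using z0 by (simp add: ln_mult)
  \<comment> \<open>The constant 512 makes the barriers at \<open>z0\<close> cost at most half of the gain from the zeros.\<close>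
  define N where "N = (\<Sum>w\<in>F. m w * (1 - norm w))"
  have "t / 8 * N \<le> (\<Sum>w\<in>F. m w * - ln (norm (b w z0)))"
    unfolding N_def sum_distrib_left
  proof (intro sum_mono)
    fix w assume w: "w \<in> F"
    have "m w * ((1 - norm w) * (1 - norm z0) / 8) \<le> m w * - ln (norm (b w z0))"
      unfolding b_def by (intro mult_left_mono m0 neg_ln_blaschke_lower) (use Fs w z0 z0F in auto)
    then show "t / 8 * (m w * (1 - norm w)) \<le> m w * - ln (norm (b w z0))"
      by (simp add: t_def mult_ac)
  qed
  moreover have "(\<Sum>w\<in>F. m w * (c w * Re (herglotz_kernel (p w) z0))) \<le> t / 16 * N"
    unfolding N_def sum_distrib_left
  proof (intro sum_mono)
    fix w assume w: "w \<in> F"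
    have "c w * Re (herglotz_kernel (p w) z0) \<le> c w * (2 / t)"
      unfolding t_def by (intro mult_left_mono herglotz_kernel_upper[where s = s] c0 w z0 s0 p)
    also have "\<dots> = t / 16 * (1 - norm w)"
      using t \<delta> by (simp add: c_def s_def field_simps power2_eq_square)
    finally show "m w * (c w * Re (herglotz_kernel (p w) z0)) \<le> t / 16 * (m w * (1 - norm w))"
      using mult_left_mono[OF _ m0[of w]] by (metis mult.left_commute)
  qed
  ultimately have "t / 8 * N \<le> Re (\<Phi> z0) + 1 - ln (norm (f z0)) + t / 16 * N"
    using main unfolding Re\<Psi> by linarith
  then have "N \<le> 16 / t * (Re (\<Phi> z0) + 1 - ln (norm (f z0)))"
    using t by (simp add: field_simps)
  then show ?thesis by (simp add: N_def m_def t_def)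
qed

section \<open>Dyadic arcs meeting E\<close>

definition grid_size :: "nat \<Rightarrow> real" where
  "grid_size k = 2 * pi / 2 ^ k"

text \<open>The indices of the arcs of the dyadic grid with \<open>2 ^ k\<close> arcs that meet \<open>E\<close>. As the arcs are disjoint and
lie near \<open>E\<close>, their number is controlled by the measure of a neighbourhood of \<open>E\<close>, which is the only
way in which the type of \<open>E\<close> enters.\<close>

definition grid_hits :: "complex set \<Rightarrow> nat \<Rightarrow> nat set" where
  "grid_hits E k = {j. j < 2 ^ k \<and>
     (\<exists>\<theta>\<in>{grid_size k * real j..<grid_size k * (real j + 1)}. cis \<theta> \<in> E)}"

lemma grid_size_pos [simp]: "grid_size k > 0"
  by (simp add: grid_size_def)

lemma grid_size_nonneg [simp]: "grid_size k \<ge> 0"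
  by (simp add: grid_size_def)

lemma grid_size_nonzero [simp]: "grid_size k \<noteq> 0"
  by (simp add: grid_size_def)

lemma grid_size_Suc: "grid_size (Suc k) = grid_size k / 2"
  by (simp add: grid_size_def)

lemma grid_size_antimono: "k \<le> l \<Longrightarrow> grid_size l \<le> grid_size k"
  by (simp add: grid_size_def divide_left_mono)

lemma grid_size_tendsto_0: "grid_size \<longlonglongrightarrow> 0"
  unfolding grid_size_def by real_asymp

lemma eventually_grid_size_less: "e > 0 \<Longrightarrow> \<forall>\<^sub>F k in sequentially. grid_size k < e"
  using grid_size_tendsto_0 by (rule order_tendstoD)

lemma finite_grid_hits [simp]: "finite (grid_hits E k)"
  unfolding grid_hits_def by (rule finite_subset[of _ "{..<2 ^ k}"]) auto

lemma norm_cis_diff_le: "norm (cis a - cis b) \<le> \<bar>a - b\<bar>"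
proof -
  have "cis a - cis b = cis b * (cis (a - b) - 1)"
    by (simp add: algebra_simps cis_mult)
  then have "norm (cis a - cis b) = norm (cis (a - b) - 1)"
    by (simp add: norm_mult)
  also have "\<dots> = 2 * \<bar>sin ((a - b) / 2)\<bar>"
    using dist_exp_i_1[of "a - b"] by (simp add: cis_conv_exp mult.commute)
  also have "\<dots> \<le> \<bar>a - b\<bar>"
    using abs_sin_x_le_abs_x[of "(a - b) / 2"] by simp
  finally show ?thesis .
qed

lemma circle_nbhd_angles_measurable:
  "{\<theta> \<in> {0..<2 * pi}. cis \<theta> \<in> circle_nbhd E x} \<in> fmeasurable lborel"
proof -
  have "{\<theta> \<in> {0..<2 * pi}. cis \<theta> \<in> circle_nbhd E x}
      = {0..<2 * pi} \<inter> {\<theta>. infdist (cis \<theta>) E < x}"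
    by (auto simp: circle_nbhd_def)
  moreover have "open {\<theta>. infdist (cis \<theta>) E < x}"
    by (intro open_Collect_less continuous_intros) 
  ultimately have "{\<theta> \<in> {0..<2 * pi}. cis \<theta> \<in> circle_nbhd E x} \<in> sets lborel"
    by auto
  moreover have "{0..2 * pi} \<in> fmeasurable lborel" by (auto simp: fmeasurable_def)
  ultimately show ?thesis by (rule fmeasurableI2[rotated 2]) auto
qed

lemma circle_measure_nbhd_le_1: "circle_measure (circle_nbhd E x) \<le> 1"
proof -
  have "measure lborel {\<theta> \<in> {0..<2 * pi}. cis \<theta> \<in> circle_nbhd E x} \<le> measure lborel {0..2 * pi}"
    using circle_nbhd_angles_measurable
    by (intro measure_mono_fmeasurable) (auto simp: fmeasurable_def)
  then show ?thesis by (simp add: circle_measure_def)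
qed

lemma card_grid_hits_le:
  "grid_size k * card (grid_hits E k) \<le> 2 * pi * circle_measure (circle_nbhd E (grid_size k))"
proof -
  define x where "x = grid_size k"
  define I where "I j = {x * real j..<x * (real j + 1)}" for j :: nat
  have x: "x > 0" by (simp add: x_def)
  have top: "x * (real j + 1) \<le> 2 * pi" if "j \<in> grid_hits E k" for j
  proof -
    have "Suc j \<le> 2 ^ k" using that by (simp add: grid_hits_def)
    then have "real j + 1 \<le> 2 ^ k" by (metis of_nat_Suc of_nat_le_iff of_nat_numeral of_nat_power add.commute)
    then have "x * (real j + 1) \<le> x * 2 ^ k" using x by (intro mult_left_mono) auto
    then show ?thesis by (simp add: x_def grid_size_def)
  qed
  have disj: "disjoint_family_on I (grid_hits E k)"
    unfolding disjoint_family_on_def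
  proof safe
    fix i j :: nat and y assume "i \<noteq> j" "y \<in> I i" "y \<in> I j"
    have "\<lfloor>y / x\<rfloor> = int i" if "y \<in> I i" for i
      using that x by (intro floor_unique) (auto simp: I_def field_simps)
    then have "int i = int j" using \<open>y \<in> I i\<close> \<open>y \<in> I j\<close> by metis
    with \<open>i \<noteq> j\<close> show "y \<in> {}" by simp
  qed
  have "x * card (grid_hits E k) = (\<Sum>j\<in>grid_hits E k. measure lborel (I j))"
    using x by (simp add: I_def algebra_simps)
  also have "\<dots> = measure lborel (\<Union>j\<in>grid_hits E k. I j)"
  proof (rule measure_finite_Union[symmetric])
    show "emeasure lborel (I j) \<noteq> \<infinity>" for j
      using x by (simp add: I_def algebra_simps)
    show "disjoint_family_on I (grid_hits E k)" by (rule disj)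
  qed (auto simp: I_def)
  also have "\<dots> \<le> measure lborel {\<theta> \<in> {0..<2 * pi}. cis \<theta> \<in> circle_nbhd E x}"
  proof (intro measure_mono_fmeasurable circle_nbhd_angles_measurable subsetI)
    fix \<theta> assume "\<theta> \<in> (\<Union>j\<in>grid_hits E k. I j)"
    then obtain j where j: "j \<in> grid_hits E k" "\<theta> \<in> I j" by blast
    then obtain \<eta> where \<eta>: "\<eta> \<in> I j" "cis \<eta> \<in> E"
      by (auto simp: grid_hits_def I_def x_def)
    have "infdist (cis \<theta>) E \<le> norm (cis \<theta> - cis \<eta>)"
      using infdist_le[OF \<eta>(2)] by (simp add: dist_norm)
    also have "\<dots> \<le> \<bar>\<theta> - \<eta>\<bar>" by (rule norm_cis_diff_le)
    also have "\<dots> < x" using j \<eta> by (auto simp: I_def algebra_simps)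
    finally have "cis \<theta> \<in> circle_nbhd E x" by (simp add: circle_nbhd_def)
    moreover have "0 \<le> \<theta>"
      using j(2) x by (auto simp: I_def intro: order_trans[rotated])
    ultimately show "\<theta> \<in> {\<theta> \<in> {0..<2 * pi}. cis \<theta> \<in> circle_nbhd E x}"
      using j top[OF j(1)] by (auto simp: I_def)
  qed (auto simp: I_def)
  finally show ?thesis by (simp add: circle_measure_def x_def)
qed

lemma grid_hit_near:
  assumes "e \<in> E" "norm e = 1"
  shows "\<exists>j\<in>grid_hits E k. norm (cis (grid_size k * real j) - e) \<le> grid_size k"
proof -
  define x where "x = grid_size k"
  have x: "x > 0" by (simp add: x_def)
  define \<theta> where "\<theta> = Arg2pi e"
  have \<theta>: "0 \<le> \<theta>" "\<theta> < 2 * pi" using Arg2pi[of e] by (auto simp: \<theta>_def)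
  have e: "e = cis \<theta>" using Arg2pi_eq[of e] assms by (simp add: \<theta>_def cis_conv_exp)
  define j where "j = nat \<lfloor>\<theta> / x\<rfloor>"
  have "real j = of_int \<lfloor>\<theta> / x\<rfloor>" using \<theta> x by (simp add: j_def)
  then have "real j \<le> \<theta> / x" "\<theta> / x < real j + 1" by linarith+
  then have j: "x * real j \<le> \<theta>" "\<theta> < x * (real j + 1)"
    using x by (simp_all add: field_simps)
  have "x * real j < x * 2 ^ k" using j \<theta> by (simp add: x_def grid_size_def)
  then have "real j < 2 ^ k" using x by simp
  then have "j < 2 ^ k" by (metis of_nat_less_iff of_nat_numeral of_nat_power)
  then have "j \<in> grid_hits E k"
    using j e assms by (auto simp: grid_hits_def x_def)
  moreover have "norm (cis (x * real j) - e) \<le> x"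
    using norm_cis_diff_le[of "x * real j" \<theta>] j e by (simp add: algebra_simps)
  ultimately show ?thesis by (auto simp: x_def)
qed

section \<open>A harmonic majorant of the profile\<close>

text \<open>A discrete substitute for the Poisson integral of \<open>max (infdist \<zeta> E) (grid_size M) powr (- \<rho>)\<close>. On
scale \<open>k\<close> every arc that meets \<open>E\<close> gets one pole, of mass equal to its length and at that distance from
the circle, so that the kernels of scale \<open>k\<close>, multiplied by the mass, add up to at least \<open>2 / 9\<close> at all
points within \<open>grid_size k\<close> of \<open>E\<close>; the weights \<open>grid_size (Suc k) powr (- \<rho>)\<close> bound the profile on the
layer between the scales \<open>k\<close> and \<open>Suc k\<close>.\<close>

definition profile_majorant :: "real \<Rightarrow> complex set \<Rightarrow> nat \<Rightarrow> complex \<Rightarrow> complex" where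
  "profile_majorant \<rho> E M z =
     (\<Sum>k\<le>M. of_real (9 / 2 * grid_size (Suc k) powr (- \<rho>) * grid_size k) *
       (\<Sum>j\<in>grid_hits E k.
          herglotz_kernel (of_real (1 + grid_size k) * cis (grid_size k * real j)) z))"

lemma norm_grid_pole: "norm (of_real (1 + grid_size k) * cis t) = 1 + grid_size k"
  using grid_size_nonneg[of k] by (simp add: norm_mult abs_of_nonneg del: of_real_add grid_size_nonneg)

lemma holomorphic_profile_majorant: "profile_majorant \<rho> E M holomorphic_on ball 0 1"
  unfolding profile_majorant_def
  by (intro holomorphic_intros holomorphic_herglotz_kernel) (simp add: norm_grid_pole del: of_real_add)

lemma Re_profile_majorant:
  "Re (profile_majorant \<rho> E M z) =
     (\<Sum>k\<le>M. 9 / 2 * grid_size (Suc k) powr (- \<rho>) * grid_size k *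
       (\<Sum>j\<in>grid_hits E k.
          Re (herglotz_kernel (of_real (1 + grid_size k) * cis (grid_size k * real j)) z)))"
  unfolding profile_majorant_def Re_sum Re_complex_of_real
  by (simp add: Re_sum del: of_real_add)

lemma profile_majorant_upper:
  assumes "norm z < 1"
  shows "Re (profile_majorant \<rho> E M z)
    \<le> 9 / (1 - norm z) * (\<Sum>k\<le>M. grid_size (Suc k) powr (- \<rho>) * (grid_size k * card (grid_hits E k)))"
proof -
  have "Re (profile_majorant \<rho> E M z)
      \<le> (\<Sum>k\<le>M. 9 / (1 - norm z) * (grid_size (Suc k) powr (- \<rho>) * (grid_size k * card (grid_hits E k))))"
    unfolding Re_profile_majorant
  proof (intro sum_mono)
    fix k
    have "(\<Sum>j\<in>grid_hits E k.
            Re (herglotz_kernel (of_real (1 + grid_size k) * cis (grid_size k * real j)) z))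
         \<le> of_nat (card (grid_hits E k)) * (2 / (1 - norm z))"
      using herglotz_kernel_upper[OF assms grid_size_pos norm_grid_pole] by (intro sum_bounded_above)
    then have "9 / 2 * grid_size (Suc k) powr (- \<rho>) * grid_size k * (\<Sum>j\<in>grid_hits E k.
            Re (herglotz_kernel (of_real (1 + grid_size k) * cis (grid_size k * real j)) z))
        \<le> 9 / 2 * grid_size (Suc k) powr (- \<rho>) * grid_size k
            * (of_nat (card (grid_hits E k)) * (2 / (1 - norm z)))"
      by (rule mult_left_mono) simp
    also have "\<dots> = 9 / (1 - norm z) * (grid_size (Suc k) powr (- \<rho>) * (grid_size k * card (grid_hits E k)))"
      by simp
    finally show "9 / 2 * grid_size (Suc k) powr (- \<rho>) * grid_size k * (\<Sum>j\<in>grid_hits E k.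
            Re (herglotz_kernel (of_real (1 + grid_size k) * cis (grid_size k * real j)) z))
       \<le> 9 / (1 - norm z) * (grid_size (Suc k) powr (- \<rho>) * (grid_size k * card (grid_hits E k)))" .
  qed
  then show ?thesis by (simp only: sum_distrib_left)
qed

text \<open>The two consecutive scales between which \<open>infdist z E\<close> lies already give the bound: \<open>z\<close> is within
\<open>grid_size k\<close> of some \<open>e\<close> in \<open>E\<close>, hence within \<open>3 * grid_size k\<close> of the pole of the arc containing \<open>e\<close>.\<close>

lemma profile_majorant_lower:
  assumes E: "closed E" "E \<subseteq> sphere 0 1" "E \<noteq> {}" and z: "norm z < 1"
    and d: "grid_size M \<le> infdist z E" and "\<rho> > 0"
  shows "infdist z E powr (- \<rho>) \<le> Re (profile_majorant \<rho> E M z)"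
proof -
  define d where "d = infdist z E"
  obtain e where e: "e \<in> E" "d = norm (z - e)"
    using infdist_attains_inf[OF E(1,3), of z] by (auto simp: d_def dist_norm)
  have e1: "norm e = 1" using e E by auto
  have "d \<le> 2" using e e1 z norm_triangle_ineq4[of z e] by simp
  then have d0: "\<not> grid_size 0 \<le> d" using pi_gt3 by (simp add: grid_size_def)
  \<comment> \<open>The coarsest scale exceeds the diameter of the disk, so the first scale below \<open>d\<close> has a
      predecessor.\<close>
  define l where "l = (LEAST k. grid_size k \<le> d)"
  have l: "grid_size l \<le> d" "l \<le> M" "\<And>k. k < l \<Longrightarrow> \<not> grid_size k \<le> d"
    using d unfolding l_def d_def[symmetric] by (auto intro: LeastI Least_le dest: not_less_Least)
  then obtain k where lk: "l = Suc k" using d0 by (cases l) auto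
  have k: "k \<le> M" "grid_size (Suc k) \<le> d" "d < grid_size k"
    using l(1,2) l(3)[of k] lk by (auto simp del: not_le simp: not_le[symmetric])
  define x where "x = grid_size k"
  have x: "x > 0" by (simp add: x_def)
  define h where "h k j = Re (herglotz_kernel (of_real (1 + grid_size k) * cis (grid_size k * real j)) z)" for k j
  have h0: "h k j \<ge> 0" for k j
    unfolding h_def
    by (rule order_trans[OF _ herglotz_kernel_lower[OF z grid_size_pos norm_grid_pole]])
       (simp add: less_imp_le)
  obtain j where j: "j \<in> grid_hits E k" "norm (cis (x * real j) - e) \<le> x"
    using grid_hit_near[OF e(1) e1, of k] by (auto simp: x_def)
  define p where "p = of_real (1 + x) * cis (x * real j)"
  have np: "norm p = 1 + x" using norm_grid_pole by (simp add: p_def x_def)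
  have "norm (p - z) \<le> 3 * x"
  proof -
    have "p - z = of_real x * cis (x * real j) + (cis (x * real j) - e) + (e - z)"
      by (simp add: p_def algebra_simps)
    then have "norm (p - z) \<le> norm (of_real x * cis (x * real j)) + norm (cis (x * real j) - e) + norm (e - z)"
      by (metis norm_triangle_mono norm_triangle_ineq order_refl)
    moreover have "norm (of_real x * cis (x * real j)) = x" using x by (simp add: norm_mult)
    moreover have "norm (e - z) \<le> x" using e k by (simp add: norm_minus_commute x_def)
    ultimately show ?thesis using j by linarith
  qed
  moreover have "norm (p - z) > 0" using norm_triangle_ineq2[of p z] np z x by linarith
  ultimately have "2 * x / (3 * x)\<^sup>2 \<le> 2 * x / (norm (p - z))\<^sup>2"
    using x by (intro divide_left_mono power_mono) auto
  also have "\<dots> \<le> h k j"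
    using herglotz_kernel_lower[OF z x np] by (simp add: h_def p_def x_def)
  finally have "2 / 9 \<le> x * h k j"
    using x by (simp add: field_simps power2_eq_square)
  then have "grid_size (Suc k) powr (- \<rho>) * (2 / 9) \<le> grid_size (Suc k) powr (- \<rho>) * (x * h k j)"
    by (intro mult_left_mono) auto
  then have "grid_size (Suc k) powr (- \<rho>) \<le> 9 / 2 * grid_size (Suc k) powr (- \<rho>) * x * h k j"
    by simp
  moreover have "d powr (- \<rho>) \<le> grid_size (Suc k) powr (- \<rho>)"
    using k grid_size_pos[of "Suc k"] \<open>\<rho> > 0\<close> by (intro powr_mono2') auto
  moreover have "9 / 2 * grid_size (Suc k) powr (- \<rho>) * x * h k j
      \<le> 9 / 2 * grid_size (Suc k) powr (- \<rho>) * x * (\<Sum>j\<in>grid_hits E k. h k j)"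
    using x by (intro mult_left_mono member_le_sum j h0) auto
  moreover have "\<dots> \<le> (\<Sum>k\<le>M. 9 / 2 * grid_size (Suc k) powr (- \<rho>) * grid_size k * (\<Sum>j\<in>grid_hits E k. h k j))"
    unfolding x_def using k(1)
    by (intro member_le_sum[where i = k and f = "\<lambda>k. 9 / 2 * grid_size (Suc k) powr (- \<rho>) * grid_size k * (\<Sum>j\<in>grid_hits E k. h k j)"])
       (auto intro!: mult_nonneg_nonneg sum_nonneg h0 less_imp_le[OF grid_size_pos])
  ultimately show ?thesis unfolding Re_profile_majorant h_def d_def by linarith
qed

lemma summable_grid_size_powr:
  assumes "\<eta> > 0"
  shows "summable (\<lambda>k. grid_size k powr \<eta>)"
proof -
  have "grid_size k powr \<eta> = (2 * pi) powr \<eta> * ((1 / 2) powr \<eta>) ^ k" for k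
  proof -
    have "grid_size k = (2 * pi) * (1 / 2) ^ k" by (simp add: grid_size_def power_divide)
    then have "grid_size k powr \<eta> = (2 * pi) powr \<eta> * ((1 / 2) ^ k) powr \<eta>"
      by (simp add: powr_mult)
    also have "((1 / 2 :: real) ^ k) powr \<eta> = ((1 / 2) powr \<eta>) ^ k"
      by (simp add: powr_power powr_powr mult.commute flip: powr_realpow)
    finally show ?thesis .
  qed
  moreover have "summable (\<lambda>k. (2 * pi) powr \<eta> * ((1 / 2) powr \<eta>) ^ k)"
    using powr_less_mono2[of \<eta> "1/2" 1] assms by (intro summable_mult summable_geometric) auto
  ultimately show ?thesis by simp
qed

text \<open>The asymptotic bound on the measure of neighbourhoods becomes uniform over all scales because only
finitely many scales escape it.\<close>

lemma grid_hits_bound_of_type: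
  assumes "(\<lambda>x. circle_measure (circle_nbhd E x)) \<in> O[at_right 0](\<lambda>x. x powr \<beta>)"
  obtains C where "C \<ge> 0" "\<And>k. grid_size k * card (grid_hits E k) \<le> C * grid_size k powr \<beta>"
proof -
  have "filterlim grid_size (at_right 0) sequentially"
    using grid_size_tendsto_0 by (simp add: filterlim_at)
  from landau_o.big.compose[OF assms this]
  have "(\<lambda>k. circle_measure (circle_nbhd E (grid_size k))) \<in> O(\<lambda>k. grid_size k powr \<beta>)" .
  then have "(\<lambda>k. grid_size k * card (grid_hits E k)) \<in> O(\<lambda>k. grid_size k powr \<beta>)"
  proof (rule landau_o.big_trans[rotated])
    show "(\<lambda>k. grid_size k * card (grid_hits E k)) \<in> O(\<lambda>k. circle_measure (circle_nbhd E (grid_size k)))"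
    proof (rule bigoI[where c = "2 * pi"], rule always_eventually, rule allI)
      fix k
      have "0 \<le> circle_measure (circle_nbhd E (grid_size k))" by (simp add: circle_measure_def)
      then show "norm (grid_size k * card (grid_hits E k)) \<le> 2 * pi * norm (circle_measure (circle_nbhd E (grid_size k)))"
        using card_grid_hits_le[of k E] by (simp add: less_imp_le[OF grid_size_pos])
    qed
  qed
  then obtain c where c: "c > 0"
      "\<forall>\<^sub>F k in sequentially. norm (grid_size k * card (grid_hits E k)) \<le> c * norm (grid_size k powr \<beta>)"
    by (elim landau_o.bigE)
  then obtain N where
      N: "\<And>k. k \<ge> N \<Longrightarrow> norm (grid_size k * card (grid_hits E k)) \<le> c * norm (grid_size k powr \<beta>)"
    unfolding eventually_sequentially by blast
  define u where "u k = grid_size k * card (grid_hits E k) / grid_size k powr \<beta>" for k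
  have u0: "u k \<ge> 0" for k by (simp add: u_def less_imp_le[OF grid_size_pos])
  show thesis
  proof (rule that[of "c + (\<Sum>k<N. u k)"])
    show "c + sum u {..<N} \<ge> 0" using c u0 by (simp add: add_nonneg_nonneg sum_nonneg less_imp_le)
    fix k
    have pos: "grid_size k powr \<beta> > 0" by simp
    have "u k \<le> c + (\<Sum>k<N. u k)"
    proof (cases "k < N")
      case True
      then have "u k \<le> (\<Sum>k<N. u k)" by (intro member_le_sum u0) auto
      then show ?thesis using c by simp
    next
      case False
      then have "grid_size k * card (grid_hits E k) \<le> c * grid_size k powr \<beta>"
        using N[of k] by simp
      then have "u k \<le> c" using pos by (simp add: u_def divide_le_eq)
      then show ?thesis using sum_nonneg[of "{..<N}" u] u0 by auto
    qed
    then show "grid_size k * card (grid_hits E k) \<le> (c + sum u {..<N}) * grid_size k powr \<beta>"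
      unfolding u_def using pos by (simp add: divide_le_eq)
  qed
qed

text \<open>On scale \<open>k\<close> the mass is at most of order \<open>grid_size k powr (\<beta> - \<rho>)\<close>. Splitting off
\<open>grid_size k powr (- q)\<close>, which is largest for \<open>k = M\<close>, leaves a positive power, whose sum over all
scales is a convergent geometric series. For \<open>q = 0\<close> this says that the total mass is bounded.\<close>

lemma profile_mass_growth:
  assumes "(\<lambda>x. circle_measure (circle_nbhd E x)) \<in> O[at_right 0](\<lambda>x. x powr \<beta>)"
    and q: "q \<ge> 0" "q > \<rho> - \<beta>"
  obtains C where "C \<ge> 0"
    "\<And>M. (\<Sum>k\<le>M. grid_size (Suc k) powr (- \<rho>) * (grid_size k * card (grid_hits E k)))
            \<le> C * grid_size M powr (- q)"
proof -
  obtain C where C: "C \<ge> 0" "\<And>k. grid_size k * card (grid_hits E k) \<le> C * grid_size k powr \<beta>"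
    using grid_hits_bound_of_type[OF assms(1)] by blast
  define \<eta> where "\<eta> = \<beta> - \<rho> + q"
  have \<eta>: "\<eta> > 0" using q by (simp add: \<eta>_def)
  define T where "T = (\<Sum>k. grid_size k powr \<eta>)"
  have T: "(\<Sum>k\<le>M. grid_size k powr \<eta>) \<le> T" for M
    unfolding T_def by (intro sum_le_suminf summable_grid_size_powr \<eta>) auto
  show thesis
  proof (rule that[of "2 powr \<rho> * C * T"])
    show "0 \<le> 2 powr \<rho> * C * T" using C order_trans[OF _ T[of 0]] by simp
    fix M
    have "(\<Sum>k\<le>M. grid_size (Suc k) powr (- \<rho>) * (grid_size k * card (grid_hits E k)))
        \<le> (\<Sum>k\<le>M. 2 powr \<rho> * C * grid_size M powr (- q) * grid_size k powr \<eta>)"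
    proof (intro sum_mono)
      fix k assume k: "k \<in> {..M}"
      have "grid_size (Suc k) powr (- \<rho>) = 2 powr \<rho> * grid_size k powr (- \<rho>)"
        by (simp add: grid_size_Suc powr_divide powr_minus_divide)
      then have "grid_size (Suc k) powr (- \<rho>) * (grid_size k * card (grid_hits E k))
          \<le> 2 powr \<rho> * grid_size k powr (- \<rho>) * (C * grid_size k powr \<beta>)"
        by (simp only:) (intro mult_left_mono C, simp)
      also have "2 powr \<rho> * grid_size k powr (- \<rho>) * (C * grid_size k powr \<beta>)
          = 2 powr \<rho> * C * (grid_size k powr (- q) * grid_size k powr \<eta>)"
        by (simp add: \<eta>_def flip: powr_add)
      also have "\<dots> \<le> 2 powr \<rho> * C * (grid_size M powr (- q) * grid_size k powr \<eta>)"
        using C q k by (intro mult_left_mono mult_right_mono powr_mono2' grid_size_antimono) auto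
      finally show "grid_size (Suc k) powr (- \<rho>) * (grid_size k * card (grid_hits E k))
          \<le> 2 powr \<rho> * C * grid_size M powr (- q) * grid_size k powr \<eta>" by (simp add: mult_ac)
    qed
    also have "\<dots> \<le> 2 powr \<rho> * C * grid_size M powr (- q) * T"
      unfolding sum_distrib_left[symmetric] using C by (intro mult_left_mono T) auto
    finally show "(\<Sum>k\<le>M. grid_size (Suc k) powr (- \<rho>) * (grid_size k * card (grid_hits E k)))
        \<le> 2 powr \<rho> * C * T * grid_size M powr (- q)" by (simp add: mult_ac)
  qed
qed

section \<open>Summation over dyadic layers\<close>

text \<open>The Jensen inequality applied with the dyadic majorant of scale \<open>M\<close>: the Blaschke sum over the zeros
at distance at least \<open>L * grid_size M\<close> from \<open>E\<close> grows at most like \<open>grid_size M powr (- q)\<close>.\<close>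

lemma zeros_away_from_E_bound:
  assumes f: "f holomorphic_on ball 0 1" and z0: "norm z0 < 1" "f z0 \<noteq> 0"
    and E: "closed E" "E \<subseteq> sphere 0 1" "E \<noteq> {}" and \<rho>: "\<rho> > 0" and A: "A \<ge> 0"
    and bd: "\<And>z. norm z < 1 \<Longrightarrow> norm (f z) \<le> exp (A * (1 + infdist z E powr (- \<rho>)))"
    and type: "(\<lambda>x. circle_measure (circle_nbhd E x)) \<in> O[at_right 0](\<lambda>x. x powr \<beta>)"
    and q: "q \<ge> 0" "q > \<rho> - \<beta>"
  obtains B D L where "B \<ge> 0" "D \<ge> 0" "L > 0"
    "\<And>M F. grid_size M < 1 - norm z0 \<Longrightarrow> finite F
       \<Longrightarrow> (\<And>w. w \<in> F \<Longrightarrow> norm w < 1 \<and> f w = 0 \<and> L * grid_size M \<le> infdist w E)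
       \<Longrightarrow> (\<Sum>w\<in>F. real (nat (zorder f w)) * (1 - norm w)) \<le> B + D * grid_size M powr (- q)"
proof -
  obtain C where C: "C \<ge> 0"
    "\<And>M. (\<Sum>k\<le>M. grid_size (Suc k) powr (- \<rho>) * (grid_size k * card (grid_hits E k)))
            \<le> C * grid_size M powr (- q)"
    using profile_mass_growth[OF type q] by blast
  define t where "t = 1 - norm z0"
  have t: "t > 0" using z0 by (simp add: t_def)
  define L where "L = 1 + 512 / t\<^sup>2"
  define B where "B = 16 / t * \<bar>A + 1 - ln (norm (f z0))\<bar>"
  define D where "D = 16 / t * (A * (9 / t * C))"
  show thesis
  proof (rule that[of B D L])
    show "B \<ge> 0" "D \<ge> 0" "L > 0"
      using t A C by (auto simp: B_def D_def L_def add_pos_nonneg)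
    fix M F
    assume M: "grid_size M < 1 - norm z0" and F: "finite F"
      "\<And>w. w \<in> F \<Longrightarrow> norm w < 1 \<and> f w = 0 \<and> L * grid_size M \<le> infdist w E"
    define \<Phi> where "\<Phi> z = of_real A + of_real A * profile_majorant \<rho> E M z" for z
    have Re\<Phi>: "Re (\<Phi> z) = A + A * Re (profile_majorant \<rho> E M z)" for z
      by (simp add: \<Phi>_def)
    have "(\<Sum>w\<in>F. real (nat (zorder f w)) * (1 - norm w))
           \<le> 16 / (1 - norm z0) * (Re (\<Phi> z0) + 1 - ln (norm (f z0)))"
    proof (rule zeros_counted_by_majorant[OF f z0 E(2,3)])
      show "\<Phi> holomorphic_on ball 0 1"
        unfolding \<Phi>_def by (intro holomorphic_intros holomorphic_profile_majorant)
      show "norm (f z) \<le> exp (Re (\<Phi> z))" if "norm z < 1" "grid_size M \<le> infdist z E" for z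
      proof -
        have "A * (1 + infdist z E powr (- \<rho>)) \<le> A * (1 + Re (profile_majorant \<rho> E M z))"
          using profile_majorant_lower[OF E that \<rho>] A by (intro mult_left_mono) auto
        then show ?thesis
          using order_trans[OF bd[OF that(1)], of "exp (Re (\<Phi> z))"]
          by (simp add: Re\<Phi> distrib_left)
      qed
      show "norm w < 1 \<and> f w = 0 \<and> (1 + 512 / (1 - norm z0)\<^sup>2) * grid_size M \<le> infdist w E"
        if "w \<in> F" for w
        using F(2)[OF that] by (simp add: L_def t_def)
    qed (use M F in auto)
    also have "\<dots> \<le> 16 / t * (\<bar>A + 1 - ln (norm (f z0))\<bar> + A * (9 / t * (C * grid_size M powr (- q))))"
    proof -
      have "Re (profile_majorant \<rho> E M z0)
          \<le> 9 / t * (\<Sum>k\<le>M. grid_size (Suc k) powr (- \<rho>) * (grid_size k * card (grid_hits E k)))"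
        unfolding t_def by (rule profile_majorant_upper[OF z0(1)])
      also have "\<dots> \<le> 9 / t * (C * grid_size M powr (- q))"
        using t by (intro mult_left_mono C(2)) auto
      finally have "A * Re (profile_majorant \<rho> E M z0) \<le> A * (9 / t * (C * grid_size M powr (- q)))"
        using A by (rule mult_left_mono)
      then have "Re (\<Phi> z0) + 1 - ln (norm (f z0))
          \<le> \<bar>A + 1 - ln (norm (f z0))\<bar> + A * (9 / t * (C * grid_size M powr (- q)))"
        unfolding Re\<Phi> by linarith
      then show ?thesis unfolding t_def[symmetric] using t by (intro mult_left_mono) auto
    qed
    also have "\<dots> = B + D * grid_size M powr (- q)"
      by (simp add: B_def D_def algebra_simps)
    finally show "(\<Sum>w\<in>F. real (nat (zorder f w)) * (1 - norm w)) \<le> B + D * grid_size M powr (- q)" .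
  qed
qed

lemma infdist_le_2:
  assumes "E \<subseteq> sphere 0 1" "E \<noteq> {}" "norm z < 1"
  shows "infdist z E \<le> 2"
proof -
  obtain e where e: "e \<in> E" using assms(2) by blast
  with assms(1) have "norm e = 1" by auto
  with e show ?thesis
    using infdist_le[of e E z] norm_triangle_ineq4[of z e] assms by (simp add: dist_norm)
qed

text \<open>Assigns a layer to each distance \<open>d\<close>: all distances from \<open>L * grid_size M0\<close> on go into the layer \<open>M0\<close>, and
below that \<open>d\<close> is comparable to the scale of its layer.\<close>

lemma dyadic_layer_exists:
  assumes "L > 0" "d > 0"
  obtains M where "M \<ge> M0" "L * grid_size M \<le> d"
    "M = M0 \<or> d < 2 * L * grid_size M"
proof -
  have "\<forall>\<^sub>F M in sequentially. grid_size M < d / L \<and> M \<ge> M0"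
    using assms by (intro eventually_conj eventually_grid_size_less eventually_ge_at_top) auto
  then obtain M where "grid_size M < d / L" "M \<ge> M0" by (auto simp: eventually_sequentially)
  then have ex: "M \<ge> M0 \<and> L * grid_size M \<le> d" using assms by (simp add: field_simps)
  define P where "P M \<longleftrightarrow> M \<ge> M0 \<and> L * grid_size M \<le> d" for M
  define M where "M = (LEAST M. P M)"
  have PM: "P M" unfolding M_def by (rule LeastI) (use ex in \<open>simp add: P_def\<close>)
  have "M = M0 \<or> d < 2 * L * grid_size M"
  proof (cases M)
    case 0 then show ?thesis using PM by (simp add: P_def)
  next
    case (Suc M')
    have "\<not> P M'" using Suc not_less_Least[of M' P] by (simp add: M_def)
    then have "M' < M0 \<or> d < L * grid_size M'" by (auto simp: P_def)
    then show ?thesis using PM Suc by (auto simp: P_def grid_size_Suc)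
  qed
  with PM show thesis using that by (auto simp: P_def)
qed

text \<open>If \<open>a = q = 0\<close>, the bound for zeros away from \<open>E\<close> does not depend on the distance and applies to every
finite set of zeros. If \<open>a > q\<close>, the zeros of layer \<open>M\<close> have weights at most of order \<open>grid_size M powr a\<close>, and
the layers sum up to a geometric series of ratio \<open>2 powr (q - a)\<close>, plus one of ratio
\<open>2 powr (- a)\<close>.\<close>

theorem weighted_zeros_summable:
  assumes f: "f holomorphic_on ball 0 1" and z0: "norm z0 < 1" "f z0 \<noteq> 0"
    and E: "closed E" "E \<subseteq> sphere 0 1" "E \<noteq> {}" and \<rho>: "\<rho> > 0" and A: "A \<ge> 0"
    and bd: "\<And>z. norm z < 1 \<Longrightarrow> norm (f z) \<le> exp (A * (1 + infdist z E powr (- \<rho>)))"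
    and type: "(\<lambda>x. circle_measure (circle_nbhd E x)) \<in> O[at_right 0](\<lambda>x. x powr \<beta>)"
    and q: "q \<ge> 0" "q > \<rho> - \<beta>" and a: "a > q \<or> a = 0 \<and> q = 0"
  shows "(\<lambda>w. of_int (zorder f w) * ((1 - norm w) * infdist w E powr a))
           summable_on {w \<in> ball 0 1. f w = 0}"
proof -
  obtain B D L where BDL: "B \<ge> 0" "D \<ge> 0" "L > 0"
    "\<And>M F. grid_size M < 1 - norm z0 \<Longrightarrow> finite F
       \<Longrightarrow> (\<And>w. w \<in> F \<Longrightarrow> norm w < 1 \<and> f w = 0 \<and> L * grid_size M \<le> infdist w E)
       \<Longrightarrow> (\<Sum>w\<in>F. real (nat (zorder f w)) * (1 - norm w)) \<le> B + D * grid_size M powr (- q)"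
    using zeros_away_from_E_bound[OF f z0 E \<rho> A bd type q] by blast
  define Z where "Z = {w \<in> ball 0 1. f w = 0}"
  define \<mu> where "\<mu> w = real (nat (zorder f w)) * (1 - norm w)" for w
  have Z: "norm w < 1" "f w = 0" "\<mu> w \<ge> 0" "infdist w E > 0" "infdist w E \<le> 2"
      "of_int (zorder f w) * (1 - norm w) = \<mu> w" if "w \<in> Z" for w
  proof -
    show w: "norm w < 1" "f w = 0" using that by (auto simp: Z_def)
    show "\<mu> w \<ge> 0" using w by (simp add: \<mu>_def)
    show "infdist w E > 0" using one_minus_norm_le_infdist[OF E(2,3), of w] w by linarith
    show "infdist w E \<le> 2" by (rule infdist_le_2[OF E(2,3) w(1)])
    have "zorder f w > 0"
      using zorder_exist_zero[OF f open_ball convex_connected[OF convex_ball], of w] w z0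
      by (metis mem_ball_0)
    then show "of_int (zorder f w) * (1 - norm w) = \<mu> w" by (simp add: \<mu>_def)
  qed
  obtain M0 where M0: "\<And>M. M \<ge> M0 \<Longrightarrow> grid_size M < 1 - norm z0"
    using eventually_grid_size_less[of "1 - norm z0"] z0 by (auto simp: eventually_sequentially)
  have layer: "(\<Sum>w\<in>G. \<mu> w) \<le> B + D * grid_size M powr (- q)"
    if "M \<ge> M0" "finite G" "G \<subseteq> Z" "\<And>w. w \<in> G \<Longrightarrow> L * grid_size M \<le> infdist w E" for M G
    unfolding \<mu>_def by (rule BDL(4)) (use that M0 Z in auto)
  have "\<exists>C. \<forall>F. finite F \<longrightarrow> F \<subseteq> Z \<longrightarrow> (\<Sum>w\<in>F. \<mu> w * infdist w E powr a) \<le> C"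
    using a
  proof
    assume a0: "a = 0 \<and> q = 0"
    have "(\<Sum>w\<in>F. \<mu> w * infdist w E powr a) \<le> B + D" if F: "finite F" "F \<subseteq> Z" for F
    proof -
      have "\<forall>\<^sub>F M in sequentially. M \<ge> M0 \<and> (\<forall>w\<in>F. grid_size M < infdist w E / L)"
        using F Z BDL by (intro eventually_conj eventually_ge_at_top eventually_ball_finite ballI
            eventually_grid_size_less) auto
      then obtain M where M: "M \<ge> M0" "\<And>w. w \<in> F \<Longrightarrow> grid_size M < infdist w E / L"
        by (auto simp: eventually_sequentially)
      have "L * grid_size M \<le> infdist w E" if "w \<in> F" for w
        using M(2)[OF that] BDL(3) by (simp add: field_simps)
      from layer[OF M(1) F this] have "(\<Sum>w\<in>F. \<mu> w) \<le> B + D" using a0 by simp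
      moreover have "(\<Sum>w\<in>F. \<mu> w * infdist w E powr a) = (\<Sum>w\<in>F. \<mu> w)"
      proof (intro sum.cong refl)
        fix w assume "w \<in> F"
        then have "infdist w E > 0" using F Z(4) by blast
        then show "\<mu> w * infdist w E powr a = \<mu> w" using a0 by simp
      qed
      ultimately show ?thesis by simp
    qed
    then show ?thesis by blast
  next
    assume aq: "a > q"
    have a0: "a > 0" using aq q by simp
    have "\<exists>M. M \<ge> M0 \<and> L * grid_size M \<le> infdist w E \<and> (M = M0 \<or> infdist w E < 2 * L * grid_size M)"
      if "w \<in> Z" for w
      using dyadic_layer_exists[OF BDL(3) Z(4)[OF that]] by metis
    then obtain lev where lev: "\<And>w. w \<in> Z \<Longrightarrow> lev w \<ge> M0"
      "\<And>w. w \<in> Z \<Longrightarrow> L * grid_size (lev w) \<le> infdist w E"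
      "\<And>w. w \<in> Z \<Longrightarrow> lev w = M0 \<or> infdist w E < 2 * L * grid_size (lev w)"
      by metis
    define \<kappa> where "\<kappa> = (2 / grid_size M0) powr a + (2 * L) powr a"
    have \<kappa>: "\<kappa> \<ge> 0" by (simp add: \<kappa>_def)
    have dk: "infdist w E powr a \<le> \<kappa> * grid_size (lev w) powr a" if w: "w \<in> Z" for w
      using lev(3)[OF w]
    proof
      assume l: "lev w = M0"
      have "infdist w E powr a \<le> ((2 / grid_size M0) * grid_size M0) powr a"
        using Z[OF w] a0 by (intro powr_mono2) auto
      also have "\<dots> = (2 / grid_size M0) powr a * grid_size (lev w) powr a"
        unfolding l by (rule powr_mult)
      also have "\<dots> \<le> \<kappa> * grid_size (lev w) powr a"
        by (intro mult_right_mono) (auto simp: \<kappa>_def)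
      finally show ?thesis .
    next
      assume "infdist w E < 2 * L * grid_size (lev w)"
      then have "infdist w E powr a \<le> (2 * L * grid_size (lev w)) powr a"
        using Z[OF w] a0 by (intro powr_mono2) auto
      also have "\<dots> = (2 * L) powr a * grid_size (lev w) powr a"
        by (rule powr_mult)
      also have "\<dots> \<le> \<kappa> * grid_size (lev w) powr a"
        by (intro mult_right_mono) (auto simp: \<kappa>_def)
      finally show ?thesis .
    qed
    define \<sigma> where "\<sigma> M = B * grid_size M powr a + D * grid_size M powr (a - q)" for M
    have \<sigma>: "summable \<sigma>" unfolding \<sigma>_def
      using a0 aq by (intro summable_add summable_mult summable_grid_size_powr) auto
    have \<sigma>0: "\<sigma> M \<ge> 0" for M using BDL by (simp add: \<sigma>_def)
    have "(\<Sum>w\<in>F. \<mu> w * infdist w E powr a) \<le> \<kappa> * (\<Sum>M. \<sigma> M)" if F: "finite F" "F \<subseteq> Z" for F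
    proof -
      have "(\<Sum>w\<in>F. \<mu> w * infdist w E powr a) \<le> (\<Sum>w\<in>F. \<kappa> * (\<mu> w * grid_size (lev w) powr a))"
      proof (intro sum_mono)
        fix w assume "w \<in> F"
        then have w: "w \<in> Z" using F by auto
        have "\<mu> w * infdist w E powr a \<le> \<mu> w * (\<kappa> * grid_size (lev w) powr a)"
          by (intro mult_left_mono dk Z w)
        then show "\<mu> w * infdist w E powr a \<le> \<kappa> * (\<mu> w * grid_size (lev w) powr a)"
          by (simp add: mult_ac)
      qed
      also have "\<dots> = \<kappa> * (\<Sum>w\<in>F. \<mu> w * grid_size (lev w) powr a)"
        by (simp add: sum_distrib_left)
      also have "(\<Sum>w\<in>F. \<mu> w * grid_size (lev w) powr a)
          = (\<Sum>M\<in>lev ` F. \<Sum>w\<in>{w\<in>F. lev w = M}. \<mu> w * grid_size (lev w) powr a)"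
        by (rule sum.image_gen[OF F(1)])
      also have "\<dots> \<le> (\<Sum>M\<in>lev ` F. \<sigma> M)"
      proof (intro sum_mono)
        fix M assume "M \<in> lev ` F"
        then have "M \<ge> M0" using lev(1) F by auto
        then have *: "(\<Sum>w\<in>{w\<in>F. lev w = M}. \<mu> w) \<le> B + D * grid_size M powr (- q)"
          by (intro layer) (use F lev(2) in auto)
        have "(\<Sum>w\<in>{w\<in>F. lev w = M}. \<mu> w * grid_size (lev w) powr a)
            = grid_size M powr a * (\<Sum>w\<in>{w\<in>F. lev w = M}. \<mu> w)"
          unfolding sum_distrib_left by (intro sum.cong) auto
        also have "\<dots> \<le> grid_size M powr a * (B + D * grid_size M powr (- q))"
          by (intro mult_left_mono *) auto
        also have "\<dots> = \<sigma> M"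
          by (simp add: \<sigma>_def algebra_simps powr_diff powr_minus_divide)
        finally show "(\<Sum>w\<in>{w\<in>F. lev w = M}. \<mu> w * grid_size (lev w) powr a) \<le> \<sigma> M" .
      qed
      also have "\<dots> \<le> (\<Sum>M. \<sigma> M)"
        by (intro sum_le_suminf \<sigma> \<sigma>0) (use F in auto)
      finally show ?thesis using \<kappa> by (simp add: mult_left_mono)
    qed
    then show ?thesis by blast
  qed
  then obtain C where C: "\<And>F. finite F \<Longrightarrow> F \<subseteq> Z \<Longrightarrow> (\<Sum>w\<in>F. \<mu> w * infdist w E powr a) \<le> C"
    by blast
  have "(\<lambda>w. \<mu> w * infdist w E powr a) summable_on Z"
  proof (rule nonneg_bounded_partial_sums_imp_summable_on)
    show "\<forall>\<^sub>F F in finite_subsets_at_top Z. (\<Sum>w\<in>F. \<mu> w * infdist w E powr a) \<le> C"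
      by (rule eventually_finite_subsets_at_top_weakI) (rule C)
  qed (use Z in auto)
  also have "?this \<longleftrightarrow> (\<lambda>w. of_int (zorder f w) * ((1 - norm w) * infdist w E powr a)) summable_on Z"
    by (intro summable_on_cong) (simp add: Z(6)[symmetric] mult.assoc)
  finally show ?thesis by (simp add: Z_def)
qed

section \<open>Growth of the derivative of a Blaschke product\<close>

lemma norm_sub_le_norm_one_minus_cnj_mult:
  assumes "norm a < 1" "norm w < 1"
  shows "norm (w - a) \<le> norm (1 - cnj a * w)"
proof (rule power2_le_imp_le)
  have "0 \<le> (1 - (norm a)\<^sup>2) * (1 - (norm w)\<^sup>2)"
    using norm_sq_less_one[OF assms(1)] norm_sq_less_one[OF assms(2)] by simp
  then show "(norm (w - a))\<^sup>2 \<le> (norm (1 - cnj a * w))\<^sup>2"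
    by (simp add: norm_one_minus_cnj_mult_sq)
qed simp

lemma norm_blaschke_factor_le_1:
  assumes "norm a < 1" "norm w < 1"
  shows "norm (blaschke_factor a w) \<le> 1"
proof -
  have "norm (a - w) / norm (1 - cnj a * w) \<le> 1"
    using norm_sub_le_norm_one_minus_cnj_mult[OF assms] one_minus_cnj_mult_nonzero[OF assms]
    by (simp add: norm_minus_commute)
  then show ?thesis
    by (simp add: blaschke_factor_def norm_mult norm_divide)
qed

lemma norm_one_minus_cnj_mult_ge:
  assumes "norm a < 1" "norm w < 1"
  shows "1 - norm w \<le> norm (1 - cnj a * w)" "1 - norm a \<le> norm (1 - cnj a * w)"
proof -
  have "1 - norm a * norm w \<le> norm (1 - cnj a * w)"
    using norm_triangle_ineq2[of 1 "cnj a * w"] by (simp add: norm_mult)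
  moreover have "norm a * norm w \<le> norm w" "norm a * norm w \<le> norm a"
    using assms by (auto intro: mult_left_le_one_le mult_right_le_one_le)
  ultimately show "1 - norm w \<le> norm (1 - cnj a * w)" "1 - norm a \<le> norm (1 - cnj a * w)"
    by linarith+
qed

lemma norm_blaschke_factor_minus_1:
  assumes a: "norm a < 1" "a \<noteq> 0" and w: "norm w \<le> r" "r < 1"
  shows "norm (blaschke_factor a w - 1) \<le> (1 - norm a) * (2 / (1 - r))"
proof -
  have w1: "norm w < 1" using w by simp
  define \<alpha> where "\<alpha> = complex_of_real (norm a)"
  have \<alpha>: "\<alpha> \<noteq> 0" "cnj a * a = \<alpha> * \<alpha>"
    using a complex_norm_square[of a] by (auto simp: \<alpha>_def power2_eq_square mult.commute)
  have nz: "1 - cnj a * w \<noteq> 0" by (rule one_minus_cnj_mult_nonzero[OF a(1) w1])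
  have "\<alpha> * (1 - cnj a * w) * (blaschke_factor a w - 1)
      = cnj a * (a - w) - \<alpha> * (1 - cnj a * w)"
  proof -
    have "blaschke_factor a w = cnj a * (a - w) / (\<alpha> * (1 - cnj a * w))"
      by (simp add: blaschke_factor_def \<alpha>_def)
    moreover have "\<alpha> * (1 - cnj a * w) \<noteq> 0" using \<alpha>(1) nz by simp
    ultimately have "\<alpha> * (1 - cnj a * w) * blaschke_factor a w = cnj a * (a - w)"
      by (metis nonzero_mult_div_cancel_left times_divide_eq_right)
    then show ?thesis by (simp only: right_diff_distrib[of "\<alpha> * (1 - cnj a * w)"] mult_1_right)
  qed
  also have "\<dots> = (\<alpha> - 1) * (\<alpha> + cnj a * w)"
    using \<alpha>(2) by (simp add: algebra_simps)
  finally have "norm (\<alpha> * (1 - cnj a * w) * (blaschke_factor a w - 1)) = norm ((\<alpha> - 1) * (\<alpha> + cnj a * w))"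
    by simp
  then have eq: "norm a * (norm (1 - cnj a * w) * norm (blaschke_factor a w - 1))
      = norm (\<alpha> - 1) * norm (\<alpha> + cnj a * w)"
    by (simp add: norm_mult \<alpha>_def mult.assoc)
  have "norm (\<alpha> - 1) = 1 - norm a"
    unfolding \<alpha>_def using a by (metis abs_minus_commute abs_of_pos diff_gt_0_iff_gt norm_of_real of_real_1 of_real_diff)
  moreover have "norm (\<alpha> + cnj a * w) \<le> norm a * 2"
  proof -
    have "norm (\<alpha> + cnj a * w) \<le> norm a + norm a * norm w"
      using norm_triangle_ineq[of \<alpha> "cnj a * w"] by (simp add: \<alpha>_def norm_mult)
    also have "norm a * norm w \<le> norm a * 1" using w1 by (intro mult_left_mono) auto
    finally show ?thesis by simp
  qed
  ultimately have "norm a * (norm (1 - cnj a * w) * norm (blaschke_factor a w - 1))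
      \<le> norm a * ((1 - norm a) * 2)"
    unfolding eq using a mult_left_mono[of "norm (\<alpha> + cnj a * w)" "norm a * 2" "1 - norm a"]
    by (simp add: mult_ac)
  then have "norm (1 - cnj a * w) * norm (blaschke_factor a w - 1) \<le> (1 - norm a) * 2"
    using a by simp
  moreover have "(1 - r) * norm (blaschke_factor a w - 1)
      \<le> norm (1 - cnj a * w) * norm (blaschke_factor a w - 1)"
    using norm_one_minus_cnj_mult_ge(1)[OF a(1) w1] w by (intro mult_right_mono) auto
  ultimately have "(1 - r) * norm (blaschke_factor a w - 1) \<le> (1 - norm a) * 2" by linarith
  then show ?thesis using w by (simp add: field_simps)
qed

text \<open>The derivative is a unimodular constant times \<open>(\<bar>a\<bar>\<^sup>2 - 1) / (1 - cnj a * w)\<^sup>2\<close>.\<close>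

lemma blaschke_factor_has_derivative:
  assumes a: "norm a < 1" "a \<noteq> 0" and w: "norm w < 1"
  shows "\<exists>D. (blaschke_factor a has_field_derivative D) (at w) \<and>
             norm D = (1 - (norm a)\<^sup>2) / (norm (1 - cnj a * w))\<^sup>2"
proof -
  define c where "c = cnj a / of_real (norm a)"
  define D where "D = c * ((a * cnj a - 1) / (1 - cnj a * w)\<^sup>2)"
  have nz: "1 - cnj a * w \<noteq> 0" by (rule one_minus_cnj_mult_nonzero[OF a(1) w])
  have bf: "blaschke_factor a = (\<lambda>w. c * ((a - w) / (1 - cnj a * w)))"
    by (simp add: blaschke_factor_def c_def fun_eq_iff)
  have "(blaschke_factor a has_field_derivative D) (at w)"
    unfolding bf D_def
    by (rule derivative_eq_intros refl nz | simp)+ (use nz in \<open>simp add: power2_eq_square field_simps\<close>)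
  moreover have "norm D = (1 - (norm a)\<^sup>2) / (norm (1 - cnj a * w))\<^sup>2"
  proof -
    have "a * cnj a - 1 = of_real ((norm a)\<^sup>2 - 1)"
      using complex_norm_square[of a] by simp
    then have "norm (a * cnj a - 1) = \<bar>(norm a)\<^sup>2 - 1\<bar>" by (metis norm_of_real)
    also have "\<dots> = 1 - (norm a)\<^sup>2" using norm_sq_less_one[OF a(1)] by simp
    finally have 1: "norm (a * cnj a - 1) = 1 - (norm a)\<^sup>2" .
    have "norm c = 1" using a by (simp add: c_def norm_divide)
    then show ?thesis unfolding D_def norm_mult norm_divide norm_power 1 by simp
  qed
  ultimately show ?thesis by blast
qed

context
  fixes z :: "nat \<Rightarrow> complex"
  assumes bs: "blaschke_sequence z" and nonzero: "\<And>n. z n \<noteq> 0"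
begin

lemma norm_zero_less_1: "norm (z n) < 1"
  using bs by (simp add: blaschke_sequence_def)

lemma summable_one_minus_norm: "summable (\<lambda>n. 1 - norm (z n))"
  using bs by (simp add: blaschke_sequence_def)

lemma convergent_prod_blaschke:
  assumes "norm w < 1"
  shows "convergent_prod (\<lambda>n. blaschke_factor (z n) w)"
proof -
  have "summable (\<lambda>n. norm (blaschke_factor (z n) w - 1))"
  proof (rule summable_comparison_test')
    show "summable (\<lambda>n. (1 - norm (z n)) * (2 / (1 - norm w)))"
      by (intro summable_mult2 summable_one_minus_norm)
    show "norm (norm (blaschke_factor (z n) w - 1)) \<le> (1 - norm (z n)) * (2 / (1 - norm w))" for n
      using norm_blaschke_factor_minus_1[OF norm_zero_less_1 nonzero order_refl assms] by simp
  qed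
  then show ?thesis
    by (intro abs_convergent_prod_imp_convergent_prod summable_imp_abs_convergent_prod)
qed

lemma blaschke_partial_products_tendsto:
  assumes "norm w < 1"
  shows "(\<lambda>N. \<Prod>n<N. blaschke_factor (z n) w) \<longlonglongrightarrow> blaschke_product z w"
  unfolding blaschke_product_def
  using convergent_prod_LIMSEQ[OF convergent_prod_blaschke[OF assms]]
  by (simp add: LIMSEQ_lessThan_iff_atMost)

lemma blaschke_uniform_limit:
  assumes "r < 1"
  shows "uniform_limit (cball 0 r) (\<lambda>N w. \<Prod>n<N. blaschke_factor (z n) w) (blaschke_product z) sequentially"
proof -
  have "uniformly_convergent_on (cball 0 r) (\<lambda>N w. \<Prod>n<N. blaschke_factor (z n) w)"
  proof (rule uniformly_convergent_on_prod')
    show "continuous_on (cball 0 r) (blaschke_factor (z n))" for n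
      unfolding blaschke_factor_def
      by (intro continuous_intros ballI one_minus_cnj_mult_nonzero norm_zero_less_1)
         (use assms nonzero in auto)
    show "uniformly_convergent_on (cball 0 r) (\<lambda>N w. \<Sum>n<N. norm (blaschke_factor (z n) w - 1))"
    proof (rule Weierstrass_m_test')
      show "summable (\<lambda>n. (1 - norm (z n)) * (2 / (1 - r)))"
        by (intro summable_mult2 summable_one_minus_norm)
      show "norm (norm (blaschke_factor (z n) w - 1)) \<le> (1 - norm (z n)) * (2 / (1 - r))"
        if "w \<in> cball 0 r" for n w
        using norm_blaschke_factor_minus_1[OF norm_zero_less_1 nonzero _ assms] that by simp
    qed
  qed simp
  then obtain g where g: "uniform_limit (cball 0 r) (\<lambda>N w. \<Prod>n<N. blaschke_factor (z n) w) g sequentially"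
    by (auto simp: uniformly_convergent_on_def)
  have "g w = blaschke_product z w" if "w \<in> cball 0 r" for w
  proof (rule LIMSEQ_unique)
    show "(\<lambda>N. \<Prod>n<N. blaschke_factor (z n) w) \<longlonglongrightarrow> g w"
      by (rule tendsto_uniform_limitI[OF g that])
    show "(\<lambda>N. \<Prod>n<N. blaschke_factor (z n) w) \<longlonglongrightarrow> blaschke_product z w"
      by (rule blaschke_partial_products_tendsto) (use that assms in auto)
  qed
  then show ?thesis
    using uniform_limit_cong'[of "cball 0 r" "\<lambda>N w. \<Prod>n<N. blaschke_factor (z n) w"
        "\<lambda>N w. \<Prod>n<N. blaschke_factor (z n) w" g] g by simp
qed

text \<open>By the product rule, since all the other factors have modulus at most 1. The bound passes to the
infinite product because the partial products converge locally uniformly.\<close>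

lemma partial_product_derivative:
  assumes w: "norm w < 1"
  shows "\<exists>D. ((\<lambda>w. \<Prod>n<N. blaschke_factor (z n) w) has_field_derivative D) (at w) \<and>
             norm D \<le> (\<Sum>n<N. (1 - (norm (z n))\<^sup>2) / (norm (1 - cnj (z n) * w))\<^sup>2)"
proof (induction N)
  case (Suc N)
  then obtain D where D: "((\<lambda>w. \<Prod>n<N. blaschke_factor (z n) w) has_field_derivative D) (at w)"
    "norm D \<le> (\<Sum>n<N. (1 - (norm (z n))\<^sup>2) / (norm (1 - cnj (z n) * w))\<^sup>2)" by blast
  obtain D' where D': "(blaschke_factor (z N) has_field_derivative D') (at w)"
    "norm D' = (1 - (norm (z N))\<^sup>2) / (norm (1 - cnj (z N) * w))\<^sup>2"
    using blaschke_factor_has_derivative[OF norm_zero_less_1 nonzero w] by blast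
  have le1: "norm (\<Prod>n<N. blaschke_factor (z n) w) \<le> 1"
    unfolding prod_norm[symmetric]
    by (intro prod_le_1) (auto intro: norm_blaschke_factor_le_1 norm_zero_less_1 w)
  have "norm (D * blaschke_factor (z N) w + D' * (\<Prod>n<N. blaschke_factor (z n) w))
      \<le> norm D * norm (blaschke_factor (z N) w) + norm D' * norm (\<Prod>n<N. blaschke_factor (z n) w)"
    using norm_triangle_ineq by (metis norm_mult)
  also have "\<dots> \<le> norm D * 1 + norm D' * 1"
    by (intro add_mono mult_left_mono le1 norm_blaschke_factor_le_1 norm_zero_less_1 w) auto
  finally have "norm (D * blaschke_factor (z N) w + D' * (\<Prod>n<N. blaschke_factor (z n) w))
      \<le> (\<Sum>n<Suc N. (1 - (norm (z n))\<^sup>2) / (norm (1 - cnj (z n) * w))\<^sup>2)"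
    using D(2) D'(2) by simp
  moreover have "((\<lambda>w. \<Prod>n<Suc N. blaschke_factor (z n) w) has_field_derivative
      (D * blaschke_factor (z N) w + D' * (\<Prod>n<N. blaschke_factor (z n) w))) (at w)"
    unfolding prod.lessThan_Suc by (rule DERIV_mult'[OF D(1) D'(1), THEN DERIV_cong]) simp
  ultimately show ?case by blast
qed auto

lemma partial_product_holomorphic:
  "(\<lambda>w. \<Prod>n<N. blaschke_factor (z n) w) holomorphic_on ball 0 1"
  unfolding holomorphic_on_open[OF open_ball] using partial_product_derivative by (metis mem_ball_0)

lemma blaschke_product_holomorphic: "blaschke_product z holomorphic_on ball 0 1"
proof (rule holomorphic_uniform_sequence[OF open_ball partial_product_holomorphic])
  fix x :: complex assume x: "x \<in> ball 0 1"
  define d where "d = (1 - norm x) / 2"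
  have "cball x d \<subseteq> cball 0 (norm x + d)"
    by (simp add: cball_subset_cball_iff)
  moreover have "norm x + d < 1" using x by (simp add: d_def field_simps)
  ultimately show "\<exists>d>0. cball x d \<subseteq> ball 0 1 \<and>
      uniform_limit (cball x d) (\<lambda>N w. \<Prod>n<N. blaschke_factor (z n) w) (blaschke_product z) sequentially"
    using x by (intro exI[of _ d] conjI uniform_limit_on_subset[OF blaschke_uniform_limit])
      (auto simp: d_def subset_iff)
qed

lemma norm_deriv_blaschke_product_le:
  assumes w: "norm w < 1" and le: "\<And>n. l \<le> norm (1 - cnj (z n) * w)" "l > 0"
  shows "norm (deriv (blaschke_product z) w) \<le> 2 * (\<Sum>n. 1 - norm (z n)) / l\<^sup>2"
proof -
  define r where "r = (1 + norm w) / 2"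
  have r: "norm w < r" "r < 1" using w by (auto simp: r_def)
  have "(\<lambda>N. (deriv ^^ 1) (\<lambda>w. \<Prod>n<N. blaschke_factor (z n) w) w) \<longlonglongrightarrow> (deriv ^^ 1) (blaschke_product z) w"
  proof (rule higher_deriv_complex_uniform_limit)
    show "uniform_limit (ball 0 r) (\<lambda>N w. \<Prod>n<N. blaschke_factor (z n) w) (blaschke_product z) sequentially"
      by (rule uniform_limit_on_subset[OF blaschke_uniform_limit[OF r(2)]]) auto
    show "\<forall>\<^sub>F N in sequentially. (\<lambda>w. \<Prod>n<N. blaschke_factor (z n) w) holomorphic_on ball 0 r"
      using r by (intro always_eventually allI holomorphic_on_subset[OF partial_product_holomorphic]) auto
  qed (use r in auto)
  then have lim: "(\<lambda>N. deriv (\<lambda>w. \<Prod>n<N. blaschke_factor (z n) w) w) \<longlonglongrightarrow> deriv (blaschke_product z) w"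
    by simp
  show ?thesis
  proof (rule Lim_norm_ubound[OF _ lim])
    show "\<forall>\<^sub>F N in sequentially. norm (deriv (\<lambda>w. \<Prod>n<N. blaschke_factor (z n) w) w)
        \<le> 2 * (\<Sum>n. 1 - norm (z n)) / l\<^sup>2"
    proof (intro always_eventually allI)
      fix N
      obtain D where D: "((\<lambda>w. \<Prod>n<N. blaschke_factor (z n) w) has_field_derivative D) (at w)"
        "norm D \<le> (\<Sum>n<N. (1 - (norm (z n))\<^sup>2) / (norm (1 - cnj (z n) * w))\<^sup>2)"
        using partial_product_derivative[OF w] by blast
      have "norm D \<le> (\<Sum>n<N. 2 / l\<^sup>2 * (1 - norm (z n)))"
      proof (rule order_trans[OF D(2)], rule sum_mono)
        fix n
        have "1 - (norm (z n))\<^sup>2 \<le> 2 * (1 - norm (z n))"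
          using zero_le_power2[of "1 - norm (z n)"] by (simp add: power2_eq_square algebra_simps)
        then have "(1 - (norm (z n))\<^sup>2) / (norm (1 - cnj (z n) * w))\<^sup>2 \<le> 2 * (1 - norm (z n)) / l\<^sup>2"
          using le norm_zero_less_1[of n] by (intro frac_le power_mono) auto
        then show "(1 - (norm (z n))\<^sup>2) / (norm (1 - cnj (z n) * w))\<^sup>2 \<le> 2 / l\<^sup>2 * (1 - norm (z n))"
          by simp
      qed
      also have "\<dots> \<le> 2 / l\<^sup>2 * (\<Sum>n. 1 - norm (z n))"
        unfolding sum_distrib_left[symmetric]
        by (intro mult_left_mono sum_le_suminf summable_one_minus_norm) (auto intro: less_imp_le norm_zero_less_1)
      finally show "norm (deriv (\<lambda>w. \<Prod>n<N. blaschke_factor (z n) w) w) \<le> 2 * (\<Sum>n. 1 - norm (z n)) / l\<^sup>2"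
        using DERIV_imp_deriv[OF D(1)] by simp
    qed
  qed simp
qed

lemma blaschke_product_nonconstant:
  "\<exists>w\<in>ball 0 1. deriv (blaschke_product z) w \<noteq> 0"
proof (rule ccontr)
  assume *: "\<not> (\<exists>w\<in>ball 0 1. deriv (blaschke_product z) w \<noteq> 0)"
  have "blaschke_product z constant_on ball 0 1"
  proof (rule has_field_derivative_0_imp_constant_on)
    fix w :: complex assume w: "w \<in> ball 0 1"
    then show "(blaschke_product z has_field_derivative 0) (at w)"
      using holomorphic_derivI[OF blaschke_product_holomorphic open_ball w] * by simp
  qed auto
  then have "blaschke_product z 0 = blaschke_product z (z 0)"
    using norm_zero_less_1[of 0] by (force simp: constant_on_def)
  moreover have "blaschke_product z (z 0) = 0"
  proof (rule LIMSEQ_unique[OF blaschke_partial_products_tendsto[OF norm_zero_less_1]])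
    have "(\<Prod>n<N. blaschke_factor (z n) (z 0)) = 0" if "N \<ge> 1" for N
      using that by (intro prod_zero) (auto simp: blaschke_factor_def intro!: bexI[of _ 0])
    then show "(\<lambda>N. \<Prod>n<N. blaschke_factor (z n) (z 0)) \<longlonglongrightarrow> 0"
      by (intro tendsto_eventually) (auto simp: eventually_sequentially)
  qed
  moreover have "blaschke_product z 0 \<noteq> 0"
    unfolding blaschke_product_def
    by (intro prodinf_nonzero convergent_prod_blaschke) (auto simp: blaschke_factor_def nonzero)
  ultimately show False by simp
qed

text \<open>This is where the Stolz region is used. A zero \<open>z n\<close> that is at least half as far from \<open>E\<close> as \<open>w\<close>
satisfies \<open>1 - \<bar>z n\<bar> \<ge> exp (- c y) / Q\<close>, where \<open>y\<close> is the profile exponent at half the distance, and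
\<open>\<bar>1 - cnj (z n) * w\<bar> \<ge> 1 - \<bar>z n\<bar>\<close>. Any other zero is far from \<open>w\<close>, and
\<open>\<bar>1 - cnj (z n) * w\<bar> \<ge> \<bar>w - z n\<bar>\<close>, which is at least half the distance of \<open>w\<close> from \<open>E\<close> and so, again,
at least \<open>exp (- c y)\<close>. Hence the denominators in the bound of the derivative cost
no more than a constant times the exponential of a multiple of \<open>infdist w E powr (- \<rho>)\<close>.\<close>

lemma deriv_blaschke_product_growth:
  assumes E: "E \<subseteq> sphere 0 1" "E \<noteq> {}" and \<rho>: "\<rho> > 0" and K: "K > 0"
    and st: "range z \<subseteq> stolz_region (exp_profile \<rho>) E K"
  obtains A where "A \<ge> 0"
    "\<And>w. norm w < 1 \<Longrightarrow> norm (deriv (blaschke_product z) w) \<le> exp (A * (1 + infdist w E powr (- \<rho>)))"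
proof -
  define S where "S = (\<Sum>n. 1 - norm (z n))"
  have S: "S \<ge> 0" unfolding S_def
    by (intro suminf_nonneg summable_one_minus_norm) (auto intro: less_imp_le norm_zero_less_1)
  \<comment> \<open>The factor \<open>1 / \<rho>\<close> is needed for \<open>u \<ge> exp (- c * u powr (- \<rho>))\<close>, which follows from
      \<open>- \<rho> * ln u = ln y \<le> y\<close>.\<close>
  define c where "c = max 1 (1 / \<rho>)"
  define Q where "Q = max K 1"
  define A where "A = max (2 * S * Q\<^sup>2) (2 * c * 2 powr \<rho>)"
  have Q: "Q \<ge> 1" "Q \<ge> K" by (auto simp: Q_def)
  show thesis
  proof (rule that[of A])
    show "A \<ge> 0" using S by (simp add: A_def le_max_iff_disj)
    fix w :: complex assume w: "norm w < 1"
    define u where "u = infdist w E / 2"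
    have u: "u > 0" using one_minus_norm_le_infdist[OF E, of w] w by (simp add: u_def)
    define y where "y = u powr (- \<rho>)"
    have y: "y > 0" using u by (simp add: y_def)
    define l where "l = exp (- (c * y)) / Q"
    have l: "l > 0" using Q by (simp add: l_def)
    have "l \<le> norm (1 - cnj (z n) * w)" for n
    proof (cases "infdist (z n) E \<ge> u")
      case True
      then have d: "infdist (z n) E > 0" using u by simp
      have "infdist (z n) E powr (- \<rho>) \<le> y"
        unfolding y_def using True u \<rho> by (intro powr_mono2') auto
      also have "y \<le> c * y" using y by (simp add: c_def)
      finally have "exp (- (c * y)) \<le> exp_profile \<rho> (infdist (z n) E)"
        using d by (simp add: exp_profile_def)
      also have "\<dots> \<le> K * (1 - norm (z n))" using st by (auto simp: stolz_region_def)
      also have "\<dots> \<le> Q * (1 - norm (z n))"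
        using Q norm_zero_less_1[of n] by (intro mult_right_mono) auto
      finally have "l \<le> 1 - norm (z n)" using Q by (simp add: l_def field_simps)
      also have "\<dots> \<le> norm (1 - cnj (z n) * w)"
        by (rule norm_one_minus_cnj_mult_ge(2)[OF norm_zero_less_1 w])
      finally show ?thesis .
    next
      case False
      have "2 * u \<le> infdist (z n) E + norm (w - z n)"
        using infdist_triangle[of w E "z n"] by (simp add: u_def dist_norm)
      then have "u \<le> norm (w - z n)" using False by linarith
      have "- \<rho> * ln u = ln y" using u by (simp add: y_def ln_powr)
      also have "\<dots> \<le> y" using y ln_le_minus_one[of y] by linarith
      finally have "- ln u \<le> 1 / \<rho> * y" using \<rho> by (simp add: field_simps)
      also have "\<dots> \<le> c * y" using y by (intro mult_right_mono) (auto simp: c_def)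
      finally have "exp (- (c * y)) \<le> exp (ln u)" by simp
      also have "\<dots> = u" using u by simp
      finally have "exp (- (c * y)) \<le> u" .
      moreover have "l \<le> exp (- (c * y))"
        unfolding l_def using Q by (simp add: divide_le_eq)
      ultimately have "l \<le> norm (w - z n)" using \<open>u \<le> norm (w - z n)\<close> by linarith
      also have "\<dots> \<le> norm (1 - cnj (z n) * w)"
        by (rule norm_sub_le_norm_one_minus_cnj_mult[OF norm_zero_less_1 w])
      finally show ?thesis .
    qed
    then have "norm (deriv (blaschke_product z) w) \<le> 2 * S / l\<^sup>2"
      unfolding S_def using l by (intro norm_deriv_blaschke_product_le w) auto
    also have "\<dots> = 2 * S * Q\<^sup>2 * exp (2 * (c * y))"
      using exp_of_nat_mult[of 2 "c * y"]
      by (simp add: l_def power_divide exp_minus field_simps flip: power_inverse)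
    also have "\<dots> \<le> exp (2 * S * Q\<^sup>2) * exp (2 * (c * y))"
      using exp_ge_add_one_self[of "2 * S * Q\<^sup>2"] by (intro mult_right_mono) (linarith, simp)
    also have "\<dots> = exp (2 * S * Q\<^sup>2 + 2 * c * 2 powr \<rho> * infdist w E powr (- \<rho>))"
      unfolding exp_add[symmetric] y_def u_def
      by (simp add: powr_divide powr_minus_divide mult_ac)
    also have "\<dots> \<le> exp (A * 1 + A * infdist w E powr (- \<rho>))"
      unfolding exp_le_cancel_iff by (intro add_mono mult_right_mono) (auto simp: A_def)
    finally show "norm (deriv (blaschke_product z) w) \<le> exp (A * (1 + infdist w E powr (- \<rho>)))"
      by (simp add: distrib_left)
  qed
qed

end

section \<open>Zeros of the derivative\<close>

text \<open>The exponent 0 is always admissible since the measure is at most 1, so the supremum is over a nonempty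
set.\<close>

lemma exponent_below_set_type:
  assumes "b < set_type E"
  obtains \<beta> where "b < \<beta>"
    "(\<lambda>x. circle_measure (circle_nbhd E x)) \<in> O[at_right 0](\<lambda>x. x powr \<beta>)"
proof -
  define X where "X = {\<beta>::real. (\<lambda>x. circle_measure (circle_nbhd E x)) \<in> O[at_right 0](\<lambda>x. x powr \<beta>)}"
  have "(\<lambda>x. circle_measure (circle_nbhd E x)) \<in> O[at_right 0](\<lambda>x::real. x powr 0)"
  proof (rule bigoI[where c = 1])
    show "\<forall>\<^sub>F x::real in at_right 0. norm (circle_measure (circle_nbhd E x)) \<le> 1 * norm (x powr 0)"
      using eventually_at_right_less[of "0::real"]
      by eventually_elim (use circle_measure_nbhd_le_1 in \<open>auto simp: circle_measure_def\<close>)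
  qed
  then have "0 \<in> X" unfolding X_def by (rule CollectI)
  then have "X \<noteq> {}" by blast
  moreover have "b < Sup X" using assms by (simp add: X_def set_type_def)
  ultimately obtain \<beta> where "\<beta> \<in> X" "b < \<beta>" using less_cSupD by blast
  then show thesis using that by (simp add: X_def)
qed

theorem theorem3:
  fixes E :: "complex set" and \<rho> K :: real and z :: "nat \<Rightarrow> complex"
  assumes "closed E" and "E \<subseteq> sphere 0 1"
    and "\<rho> > 0" and "K > 0"
    and "blaschke_sequence z" and "\<And>n. z n \<noteq> 0"
    and "range z \<subseteq> stolz_region (exp_profile \<rho>) E K"
  shows "\<forall>\<epsilon>>0. (\<lambda>w. of_int (zorder (deriv (blaschke_product z)) w) *
             ((1 - norm w) * infdist w E powr max (\<rho> - set_type E + \<epsilon>) 0))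
           summable_on {w \<in> ball 0 1. deriv (blaschke_product z) w = 0}"
proof (intro allI impI)
  fix \<epsilon> :: real assume \<epsilon>: "\<epsilon> > 0"
  define a where "a = max (\<rho> - set_type E + \<epsilon>) 0"
  \<comment> \<open>An exponent strictly between \<open>\<rho> - set_type E\<close> and \<open>a\<close> if \<open>a > 0\<close>, and 0 if \<open>a = 0\<close>: then even the
      exponent 0 exceeds \<open>\<rho> - set_type E\<close>.\<close>
  define q where "q = max (a - \<epsilon> / 2) (a / 2)"
  show "(\<lambda>w. of_int (zorder (deriv (blaschke_product z)) w) *
             ((1 - norm w) * infdist w E powr max (\<rho> - set_type E + \<epsilon>) 0))
           summable_on {w \<in> ball 0 1. deriv (blaschke_product z) w = 0}"
  proof (cases "E = {}")
    case True
    \<comment> \<open>The distance to the empty set is 0, and so is every power of it.\<close>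
    then show ?thesis by (simp add: infdist_def)
  next
    case False
    have "a \<ge> 0" "a \<ge> \<rho> - set_type E + \<epsilon>" by (auto simp: a_def)
    moreover have "q \<ge> a - \<epsilon> / 2" "q \<ge> a / 2" "a > 0 \<Longrightarrow> q < a" "a = 0 \<Longrightarrow> q = 0"
      using \<epsilon> by (auto simp: q_def)
    ultimately have q: "q \<ge> 0" "a > q \<or> a = 0 \<and> q = 0" "\<rho> - q < set_type E"
      using \<epsilon> by linarith+
    obtain \<beta> where \<beta>: "\<rho> - q < \<beta>"
      "(\<lambda>x. circle_measure (circle_nbhd E x)) \<in> O[at_right 0](\<lambda>x. x powr \<beta>)"
      using exponent_below_set_type[OF q(3)] by blast
    obtain A where A: "A \<ge> 0"
      "\<And>w. norm w < 1 \<Longrightarrow> norm (deriv (blaschke_product z) w) \<le> exp (A * (1 + infdist w E powr (- \<rho>)))"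
      using deriv_blaschke_product_growth[OF assms(5,6,2) False assms(3,4,7)] by blast
    obtain z0 where z0: "norm z0 < 1" "deriv (blaschke_product z) z0 \<noteq> 0"
      using blaschke_product_nonconstant[OF assms(5,6)] by auto
    have "deriv (blaschke_product z) holomorphic_on ball 0 1"
      by (intro holomorphic_deriv blaschke_product_holomorphic assms) auto
    from weighted_zeros_summable[OF this z0 assms(1,2) False assms(3) A \<beta>(2) q(1) _ q(2)]
    show ?thesis using \<beta>(1) by (simp add: a_def)
  qed
qed

end
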